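(* Let $T$ be a tree with $n$ vertices $v_1,\dots,v_n$, let $B_T=(L_T+I_n)^{-1}$, and fix $i\le n$. Algorithm $B_T$ (described below) with input $T$ and $v_i$ outputs exactly the $i$-th column of $B_T$, and it uses $O(n)$ steps. Consequently, running it for all $i$ gives an $O(n^2)$ algorithm to compute $B_T$. Algorithm $B_T$: (0) Construct the directed tree $T^{(i)}$. (1) For each directed edge $(v_p,v_k)$ with $k\ne i$ and $v_k$ a pendant vertex, set $m_{pk}=2$. (2)(a) Choose a directed edge $(v_p,v_k)$ such that every edge in $\delta^+(v_k)$ already has a label, and set $m_{pk}=d_k+1-\sum_{j:(v_k,v_j)\in\delta^+(v_k)}1/m_{kj}$; (b) repeat (a) until all edges are labeled. (3)(a) Set $x_i=\big(d_i+1-\sum_{j:(v_i,v_j)\in\delta^+(v_i)}1/m_{ij}\big)^{-1}$; (b) for each directed edge $(v_p,v_k)$ such that $x_p$ has been computed, set $x_k=x_p/m_{pk}$. Output $x=(x_1,\dots,x_n)$.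
   Context: $L_T=D-A$ is the Laplacian matrix of $T$ ($A$ adjacency matrix, $D$ diagonal matrix of degrees), with row/column $i$ corresponding to vertex $v_i$; $L_T+I_n$ is positive definite, hence invertible. $T^{(i)}$ is the directed tree obtained from $T$ by directing every edge away from the root $v_i$. For a vertex $v_k$, $\delta^+(v_k)$ is the set of outgoing edges $(v_k,v_s)$ of $v_k$ in $T^{(i)}$, and $d_k$ is the degree of $v_k$ in $T$. A pendant vertex is a vertex of degree $1$. *)

theory Defs
  imports
    "Graph_Theory.Graph_Theory"
    "Jordan_Normal_Form.Gauss_Jordan_Elimination"
    "HOL-Library.Landau_Symbols"
begin

section \<open>Trees and their Laplacians\<close>

text \<open>
  An undirected simple graph is a \<open>pair_graph\<close>: a finite loop-free digraph with a symmetric set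
  of arcs, so that an undirected edge is a pair of opposite arcs and the degree of a vertex is its
  out-degree.  The library's \<open>tree\<close> forbids every directed cycle, including the 2-cycle formed by
  the two arcs of one edge, and is therefore not the notion wanted here; the cycles of the
  undirected graph are the directed cycles of length at least 3.
\<close>

definition undirected_tree :: "'a pair_pre_digraph \<Rightarrow> bool" where
  "undirected_tree T \<longleftrightarrow> pair_graph T \<and> Digraph_Component.connected (with_proj T) \<and>
     \<not> (\<exists>c. pre_digraph.cycle (with_proj T) c \<and> 3 \<le> length c)"

abbreviation deg :: "'a pair_pre_digraph \<Rightarrow> 'a \<Rightarrow> nat" where
  "deg T v \<equiv> out_degree (with_proj T) v"

text \<open>The vertices \<open>v\<^sub>1, \<dots>, v\<^sub>n\<close> are numbered \<open>0, \<dots>, n - 1\<close>, like the rows and columns of matrices.\<close>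

definition degree_mat :: "nat \<Rightarrow> nat pair_pre_digraph \<Rightarrow> real mat" where
  "degree_mat n T = mat n n (\<lambda>(j, k). if j = k then real (deg T j) else 0)"

definition adjacency_mat :: "nat \<Rightarrow> nat pair_pre_digraph \<Rightarrow> real mat" where
  "adjacency_mat n T = mat n n (\<lambda>(j, k). if (j, k) \<in> parcs T then 1 else 0)"

definition laplacian :: "nat \<Rightarrow> nat pair_pre_digraph \<Rightarrow> real mat" where
  "laplacian n T = degree_mat n T - adjacency_mat n T"

definition B_mat :: "nat \<Rightarrow> nat pair_pre_digraph \<Rightarrow> real mat" where
  "B_mat n T = the (mat_inverse (laplacian n T + 1\<^sub>m n))"

text \<open>An edge points away from \<open>r\<close> when it is traversed from \<open>p\<close> to \<open>k\<close> by a path starting in \<open>r\<close>.\<close>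

definition directed_tree :: "'a pair_pre_digraph \<Rightarrow> 'a \<Rightarrow> ('a \<times> 'a) set" where
  "directed_tree T r = {(p, k). \<exists>w. pre_digraph.apath (with_proj T) r (w @ [(p, k)]) k}"


section \<open>The algorithm\<close>

text \<open>
  The algorithm is a transition system on the states below; each choice it makes is left open.
  A transition carries a cost, the number of elementary steps it takes up to a constant factor, on
  a machine on which arithmetic on reals, array access, and insertion into and removal
  from a worklist are elementary.  The tree is given by adjacency lists, so that the degree of a
  vertex is read off and enumerating the neighbours of \<open>p\<close> takes \<open>deg T p\<close> steps.

  The fields \<open>frontier\<close>, \<open>unscanned\<close> and \<open>agenda\<close> are worklists.  The agenda serves only to make
  the choices of the phases \<open>Inner\<close> and \<open>Solve\<close> elementary.  The guards of these phases
  do not consult it; that it holds precisely the edges they admit is \<open>agenda_exact\<close> below.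
  Provided some transition is always possible, the tests that all edges are labelled and that all
  unknowns are computed then amount to the agenda being empty.
  The counter \<open>pending p\<close> is the number of edges leaving \<open>p\<close> that are not yet labelled.
\<close>

datatype phase = Orient | Pendant | Inner | Solve | Done

record bt_state =
  phase_of :: phase
  dtree :: "(nat \<times> nat) set"
  reached :: "nat set"
  frontier :: "nat set"
  unscanned :: "(nat \<times> nat) set"
  label :: "nat \<times> nat \<Rightarrow> real option"
  pending :: "nat \<Rightarrow> nat"
  agenda :: "(nat \<times> nat) set"
  sol :: "nat \<Rightarrow> real option"

definition init_state :: "nat \<Rightarrow> bt_state" where
  "init_state i = \<lparr> phase_of = Orient, dtree = {}, reached = {i}, frontier = {i}, unscanned = {},
     label = (\<lambda>_. None), pending = (\<lambda>_. 0), agenda = {}, sol = (\<lambda>_. None) \<rparr>"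

definition dout :: "bt_state \<Rightarrow> nat \<Rightarrow> (nat \<times> nat) set" where
  "dout s k = {e \<in> dtree s. fst e = k}"

definition out_value :: "nat pair_pre_digraph \<Rightarrow> bt_state \<Rightarrow> nat \<Rightarrow> real" where
  "out_value T s k = real (deg T k) + 1 - (\<Sum>e \<in> dout s k. 1 / the (label s e))"

text \<open>
  Labelling an edge takes constantly many steps once the value is known: the only edge it can
  make available is the one entering \<open>p\<close>, which exists for \<open>p \<noteq> i\<close> only and is unique.
\<close>

definition set_label :: "nat \<times> nat \<Rightarrow> real \<Rightarrow> bt_state \<Rightarrow> bt_state" where
  "set_label e m s = (let p = fst e in
     s\<lparr> label := (label s)(e := Some m),
        pending := (pending s)(p := pending s p - 1),
        agenda := (agenda s - {e}) \<union> (if pending s p = 1 then {e' \<in> dtree s. snd e' = p} else {}) \<rparr>)"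

inductive bt_step :: "nat pair_pre_digraph \<Rightarrow> nat \<Rightarrow> bt_state \<Rightarrow> nat \<Rightarrow> bt_state \<Rightarrow> bool"
  for T :: "nat pair_pre_digraph" and i :: nat where
  orient:
    "phase_of s = Orient \<Longrightarrow> p \<in> frontier s \<Longrightarrow>
     new = {k. (p, k) \<in> parcs T \<and> k \<notin> reached s} \<Longrightarrow>
     bt_step T i s (1 + deg T p)
       (s\<lparr> dtree := dtree s \<union> {p} \<times> new,
           reached := reached s \<union> new,
           frontier := (frontier s - {p}) \<union> new,
           pending := (pending s)(p := card new) \<rparr>)"
| orient_end:
    "phase_of s = Orient \<Longrightarrow> frontier s = {} \<Longrightarrow>
     bt_step T i s 1 (s\<lparr> phase_of := Pendant, unscanned := dtree s \<rparr>)"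
| pendant_label:
    "phase_of s = Pendant \<Longrightarrow> (p, k) \<in> unscanned s \<Longrightarrow> k \<noteq> i \<Longrightarrow> deg T k = 1 \<Longrightarrow>
     bt_step T i s 1 (set_label (p, k) 2 (s\<lparr> unscanned := unscanned s - {(p, k)} \<rparr>))"
| pendant_skip:
    "phase_of s = Pendant \<Longrightarrow> (p, k) \<in> unscanned s \<Longrightarrow> \<not> (k \<noteq> i \<and> deg T k = 1) \<Longrightarrow>
     bt_step T i s 1 (s\<lparr> unscanned := unscanned s - {(p, k)} \<rparr>)"
| pendant_end:
    "phase_of s = Pendant \<Longrightarrow> unscanned s = {} \<Longrightarrow>
     bt_step T i s 1 (s\<lparr> phase_of := Inner \<rparr>)"
| inner_label:
    "phase_of s = Inner \<Longrightarrow> (p, k) \<in> dtree s \<Longrightarrow> label s (p, k) = None \<Longrightarrow>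
     \<forall>e \<in> dout s k. label s e \<noteq> None \<Longrightarrow>
     bt_step T i s (1 + card (dout s k)) (set_label (p, k) (out_value T s k) s)"
| root:
    "phase_of s = Inner \<Longrightarrow> \<forall>e \<in> dtree s. label s e \<noteq> None \<Longrightarrow>
     bt_step T i s (1 + card (dout s i))
       (s\<lparr> phase_of := Solve, sol := (sol s)(i := Some (inverse (out_value T s i))),
           agenda := agenda s \<union> dout s i \<rparr>)"
| solve:
    "phase_of s = Solve \<Longrightarrow> (p, k) \<in> dtree s \<Longrightarrow> sol s p = Some xp \<Longrightarrow> sol s k = None \<Longrightarrow>
     bt_step T i s (1 + card (dout s k))
       (s\<lparr> sol := (sol s)(k := Some (xp / the (label s (p, k)))),
           agenda := (agenda s - {(p, k)}) \<union> dout s k \<rparr>)"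
| solve_end:
    "phase_of s = Solve \<Longrightarrow> \<forall>k \<in> pverts T. sol s k \<noteq> None \<Longrightarrow>
     bt_step T i s 1 (s\<lparr> phase_of := Done \<rparr>)"

definition agenda_exact :: "bt_state \<Rightarrow> bool" where
  "agenda_exact s \<longleftrightarrow>
     (phase_of s = Inner \<longrightarrow>
        agenda s = {(p, k) \<in> dtree s. label s (p, k) = None \<and> (\<forall>e \<in> dout s k. label s e \<noteq> None)}) \<and>
     (phase_of s = Solve \<longrightarrow>
        agenda s = {(p, k) \<in> dtree s. sol s p \<noteq> None \<and> sol s k = None})"

text \<open>
  \<open>bt_run T i s t\<close>: some (possibly unfinished) run for the root \<open>i\<close> has led to \<open>s\<close> in \<open>t\<close> steps.
  Clearing the arrays at the start is charged with the number of vertices.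
\<close>

inductive bt_run :: "nat pair_pre_digraph \<Rightarrow> nat \<Rightarrow> bt_state \<Rightarrow> nat \<Rightarrow> bool"
  for T :: "nat pair_pre_digraph" and i :: nat where
  start: "bt_run T i (init_state i) (card (pverts T))"
| continue: "bt_run T i s t \<Longrightarrow> bt_step T i s c s' \<Longrightarrow> bt_run T i s' (t + c)"

definition bt_output :: "nat \<Rightarrow> bt_state \<Rightarrow> real vec" where
  "bt_output n s = vec n (\<lambda>k. the (sol s k))"

text \<open>
  The algorithm for the whole matrix: run the above for \<open>i = 0, \<dots>, n - 1\<close>, storing each of the
  outputs as a column, in \<open>n\<close> steps.
\<close>

definition computes_matrix :: "nat \<Rightarrow> nat pair_pre_digraph \<Rightarrow> real mat \<Rightarrow> nat \<Rightarrow> bool" where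
  "computes_matrix n T X t \<longleftrightarrow> (\<exists>s c.
     (\<forall>i<n. bt_run T i (s i) (c i) \<and> phase_of (s i) = Done) \<and>
     X = mat_of_cols n (map (\<lambda>i. bt_output n (s i)) [0..<n]) \<and>
     t = (\<Sum>i<n. c i + n))"

end

theory Submission
  imports Defs "Jordan_Normal_Form.Determinant"
begin

text \<open>
  In a tree every vertex \<open>k \<noteq> i\<close> has a unique parent \<open>p\<close> in \<open>T\<^sup>(\<^sup>i\<^sup>)\<close>, so row \<open>k\<close> of
  \<open>(L\<^sub>T + I) x = e\<^sub>i\<close> reads \<open>(d\<^sub>k + 1) x\<^sub>k - x\<^sub>p - (\<Sum>\<^sub>j x\<^sub>j) = 0\<close>, with \<open>j\<close> ranging over the children.
  Eliminating from the leaves with the ansatz \<open>x\<^sub>p = m\<^sub>p\<^sub>k x\<^sub>k\<close> turns this into the recursion for the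
  labels, and row \<open>i\<close> into the formula for \<open>x\<^sub>i\<close>.  Labels are at least 2: \<open>k\<close> has \<open>d\<^sub>k - 1\<close>
  children, each contributing at most 1 to the subtracted sum.  Thus every output solves
  \<open>(L\<^sub>T + I) x = e\<^sub>i\<close>; the outputs for all \<open>i\<close> together form a right inverse of \<open>L\<^sub>T + I\<close>, which gives
  invertibility without appealing to positive definiteness.  As for the cost, each phase visits every
  vertex or edge at most once, and the degrees sum up to \<open>2 n - 2\<close>.
\<close>

section \<open>Rooted trees\<close>

locale rooted_tree = pair_graph T for T :: "'a pair_pre_digraph" +
  fixes r :: 'a
  assumes connected: "Digraph_Component.connected (with_proj T)"
    and no_long_cycle: "cycle c \<Longrightarrow> length c < 3"
    and root_in: "r \<in> pverts T"
begin

section \<open>Uniqueness and existence of paths in a tree\<close>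

lemma apath_arc_back:
  assumes "(u, a) \<in> parcs T" and p: "apath a p u"
  shows "p = [(a, u)]"
proof -
  \<comment> \<open>The arc from \<open>u\<close> to \<open>a\<close> closes \<open>p\<close> to a
    cycle; length below 3 leaves room for at most one arc in \<open>p\<close>, and \<open>p\<close>
    cannot be empty because there are no loops.\<close>
  have "cycle ((u, a) # p)"
    unfolding cycle_def using assms by (auto simp: apath_def awalk_Cons_iff)
  from no_long_cycle[OF this] have "length p \<le> 1" by simp
  moreover have "p \<noteq> []"
    using p no_loops'[OF assms(1)] by (auto simp: apath_Nil_iff)
  ultimately obtain e where "p = [e]" by (cases p) auto
  with p show ?thesis by (cases e) (auto simp: apath_simps)
qed

text \<open>Suppose the paths leave \<open>u\<close> towards \<open>a\<close> and \<open>b\<close>.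
  Going from \<open>a\<close> to \<open>v\<close> along the first and back to \<open>b\<close> along
  the second avoids \<open>u\<close>; shortened to a path and extended by \<open>(b, u)\<close>, it
  returns from \<open>a\<close> to \<open>u\<close>. By \<open>apath_arc_back\<close> this is the
  single arc \<open>(a, u)\<close>, so \<open>a = b\<close>, and the induction hypothesis compares
  the rest.\<close>

lemma apath_unique:
  assumes "apath u p v" "apath u q v"
  shows "p = q"
  using assms
proof (induction p arbitrary: u q)
  case Nil
  then show ?case using apath_nonempty_ends by (fastforce simp: apath_Nil_iff)
next
  case (Cons e p)
  obtain a where e: "e = (u, a)" "(u, a) \<in> parcs T" and p: "apath a p v" "u \<notin> set (awalk_verts a p)"
    using Cons.prems(1) by (cases e) (auto simp: apath_Cons_iff)
  have "u \<noteq> v" using apath_nonempty_ends[OF Cons.prems(1)] by simp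
  then obtain e' q' where "q = e' # q'" using Cons.prems(2) by (cases q) (auto simp: apath_Nil_iff)
  then obtain b where b: "q = (u, b) # q'" "(u, b) \<in> parcs T"
    and q': "apath b q' v" "u \<notin> set (awalk_verts b q')"
    using Cons.prems(2) by (cases e') (auto simp: apath_Cons_iff)
  have "a = b"
  proof -
    let ?w = "p @ rev_path q'"
    have ap: "awalk a p v" and aq: "awalk b q' v" using p(1) q'(1) by (auto simp: apath_def)
    have ar: "awalk v (rev_path q') b" using aq by simp
    have w: "awalk a ?w b" using awalk_appendI[OF ap ar] .
    have uw: "u \<notin> set (awalk_verts a ?w)"
      using p(2) q'(2) awalk_verts_rev_path[OF aq] set_awalk_verts_append[OF ap ar] by simp
    let ?x = "awalk_to_apath ?w"
    have x: "apath a ?x b" using apath_awalk_to_apath[OF w] .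
    have "set (awalk_verts a ?x) \<subseteq> set (awalk_verts a ?w)"
      using awalk_to_apath_subset[OF w] set_awalk_verts[OF w] set_awalk_verts[of a ?x b] x
      by (auto simp: apath_def)
    with uw have ux: "u \<notin> set (awalk_verts a ?x)" by auto
    have l: "awlast a ?x = b" using x by (auto simp: apath_def)
    have "apath b [(b, u)] u"
      using b(2) arcs_symmetric no_loops' in_arcsD1 by (auto simp: apath_simps)
    then have "apath a (?x @ [(b, u)]) u"
      using x ux l by (subst apath_append_iff) simp
    from apath_arc_back[OF e(2) this] show ?thesis by (cases ?x) auto
  qed
  then show ?case using Cons.IH[OF p(1)] q'(1) e(1) b(1) by simp
qed

lemma ex_apath: "v \<in> pverts T \<Longrightarrow> \<exists>p. apath r p v"
proof -
  assume v: "v \<in> pverts T"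
  have "strongly_connected (with_proj T)"
    using symmetric_connected_imp_strongly_connected connected pair_sym_arcs by blast
  then show ?thesis
    using v root_in reachable_apath[of r v] by (auto simp: strongly_connected_def)
qed

section \<open>Distance from the root and orientation of the edges away from it\<close>

definition depth :: "'a \<Rightarrow> nat" where
  "depth v = length (THE p. apath r p v)"

lemma depth_eq: "apath r p v \<Longrightarrow> depth v = length p"
  unfolding depth_def by (metis apath_unique the_equality)

lemma directed_treeE:
  assumes "(p, k) \<in> directed_tree T r"
  obtains w where "apath r w p" "apath r (w @ [(p, k)]) k" "(p, k) \<in> parcs T"
proof -
  obtain w where w: "apath r (w @ [(p, k)]) k" using assms by (auto simp: directed_tree_def)
  then have "apath r w (awlast r w)" "apath (awlast r w) [(p, k)] k"
    by (auto simp: apath_append_iff)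
  then show ?thesis using that w by (auto simp: apath_simps)
qed

lemma directed_tree_arc: "(p, k) \<in> directed_tree T r \<Longrightarrow> (p, k) \<in> parcs T"
  by (elim directed_treeE)

lemma directed_tree_verts:
  "(p, k) \<in> directed_tree T r \<Longrightarrow> p \<in> pverts T" "(p, k) \<in> directed_tree T r \<Longrightarrow> k \<in> pverts T"
  using directed_tree_arc in_arcsD1 in_arcsD2 by blast+

text \<open>The path to \<open>k\<close> extends the path to \<open>p\<close> by one arc. This
  strict growth excludes edges into the root and pairs of opposite edges, and it carries the later
  inductions along the tree.\<close>

lemma depth_directed_tree: "(p, k) \<in> directed_tree T r \<Longrightarrow> depth k = Suc (depth p)"
  by (elim directed_treeE) (simp add: depth_eq)

text \<open>Both edges are the last arc of the one path from the root to \<open>k\<close>.\<close>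

lemma parent_unique: "(p, k) \<in> directed_tree T r \<Longrightarrow> (q, k) \<in> directed_tree T r \<Longrightarrow> p = q"
  by (elim directed_treeE) (metis apath_unique last_snoc prod.inject)

lemma root_no_parent: "(p, r) \<notin> directed_tree T r"
  using depth_directed_tree[of p r] depth_eq[of "[]" r] root_in by (auto simp: apath_Nil_iff)

lemma ex_parent:
  assumes "k \<in> pverts T" "k \<noteq> r"
  obtains p where "(p, k) \<in> directed_tree T r"
proof -
  obtain w where w: "apath r w k" using ex_apath assms by blast
  then have "w \<noteq> []" using assms by (auto simp: apath_Nil_iff)
  then obtain w' e where e: "w = w' @ [e]" by (metis rev_exhaust)
  with w have "snd e = k" by (auto simp: apath_append_iff apath_simps)
  with w e have "(fst e, k) \<in> directed_tree T r" by (auto simp: directed_tree_def)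
  then show ?thesis by (rule that)
qed

text \<open>If \<open>k\<close> is off the path to \<open>j\<close>, that path extends by
  \<open>(j, k)\<close>. If \<open>k\<close> is on it, the section from \<open>k\<close> to
  \<open>j\<close> must be the arc \<open>(k, j)\<close> by \<open>apath_arc_back\<close>.\<close>

lemma arc_cases:
  assumes "(j, k) \<in> parcs T"
  shows "(j, k) \<in> directed_tree T r \<or> (k, j) \<in> directed_tree T r"
proof -
  obtain w where w: "apath r w j" using ex_apath assms in_arcsD1 by blast
  have l: "awlast r w = j" using w by (auto simp: apath_def)
  show ?thesis
  proof (cases "k \<in> set (awalk_verts r w)")
    case False
    have "apath j [(j, k)] k"
      using assms no_loops' in_arcsD2 by (auto simp: apath_simps)
    with w l False have "apath r (w @ [(j, k)]) k"
      by (subst apath_append_iff) simp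
    then show ?thesis by (auto simp: directed_tree_def)
  next
    case True
    then obtain w1 w2 where s: "w = w1 @ w2" "awalk r w1 k" "awalk k w2 j"
      using w awalk_decomp by (metis apath_def)
    then have "awlast r w1 = k" by auto
    then have "apath k w2 j"
      using w s by (auto simp: apath_append_iff)
    then have "w2 = [(k, j)]" using apath_arc_back assms by blast
    then show ?thesis using s w by (auto simp: directed_tree_def)
  qed
qed

section \<open>Children, degrees and the number of edges\<close>

abbreviation out_edges :: "'a \<Rightarrow> ('a \<times> 'a) set" where
  "out_edges k \<equiv> {e \<in> directed_tree T r. fst e = k}"

lemma finite_directed_tree: "finite (directed_tree T r)"
  by (rule finite_subset[OF _ pair_finite_arcs]) (use directed_tree_arc in auto)

lemma directed_tree_antisym: "(p, k) \<in> directed_tree T r \<Longrightarrow> (k, p) \<notin> directed_tree T r"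
  using depth_directed_tree[of p k] depth_directed_tree[of k p] by auto

lemma inj_on_snd_out_edges: "inj_on snd (out_edges k)"
  by (auto simp: inj_on_def)

lemma inj_on_snd_directed_tree: "inj_on snd (directed_tree T r)"
  by (auto simp: inj_on_def dest: parent_unique)

lemma snd_directed_tree: "snd ` directed_tree T r = pverts T - {r}"
proof (intro equalityI subsetI)
  fix k assume "k \<in> pverts T - {r}"
  then obtain p where "(p, k) \<in> directed_tree T r" using ex_parent by blast
  then show "k \<in> snd ` directed_tree T r" by force
qed (auto simp: directed_tree_verts root_no_parent)

lemma neighbours_root: "{j. (r, j) \<in> parcs T} = snd ` out_edges r"
  using arc_cases[of r] root_no_parent directed_tree_arc by (force simp: image_iff)

text \<open>Besides giving the degree of a non-root vertex, this disjoint splitting separates the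
  parent term from the children in a row of the linear system.\<close>

lemma neighbours:
  assumes "(p, k) \<in> directed_tree T r"
  shows "{j. (k, j) \<in> parcs T} = insert p (snd ` out_edges k)" "p \<notin> snd ` out_edges k"
proof -
  show "{j. (k, j) \<in> parcs T} = insert p (snd ` out_edges k)"
  proof (intro equalityI subsetI)
    fix j assume "j \<in> {j. (k, j) \<in> parcs T}"
    then show "j \<in> insert p (snd ` out_edges k)"
      using arc_cases[of k j] parent_unique[OF assms] by (auto simp: image_iff)
  next
    fix j assume "j \<in> insert p (snd ` out_edges k)"
    then show "j \<in> {j. (k, j) \<in> parcs T}"
      using directed_tree_arc assms arcs_symmetric by auto
  qed
  show "p \<notin> snd ` out_edges k" using directed_tree_antisym[OF assms] by auto
qed

lemma deg_card: "deg T k = card {j. (k, j) \<in> parcs T}"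
proof -
  have "out_arcs (with_proj T) k = Pair k ` {j. (k, j) \<in> parcs T}"
    by (auto simp: out_arcs_def)
  then show ?thesis by (simp add: out_degree_def card_image inj_on_def)
qed

lemma deg_root: "deg T r = card (out_edges r)"
  by (simp add: deg_card neighbours_root card_image inj_on_snd_out_edges)

lemma deg_nonroot: "(p, k) \<in> directed_tree T r \<Longrightarrow> deg T k = Suc (card (out_edges k))"
  using neighbours[of p k] finite_directed_tree
  by (simp add: deg_card card_image inj_on_snd_out_edges)

lemma deg_bounds:
  assumes "k \<in> pverts T"
  shows "card (out_edges k) \<le> deg T k" "deg T k \<le> Suc (card (out_edges k))"
proof -
  have "deg T k = card (out_edges k) \<or> deg T k = Suc (card (out_edges k))"
  proof (cases "k = r")
    case True
    then show ?thesis using deg_root by simp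
  next
    case False
    then obtain p where "(p, k) \<in> directed_tree T r" using ex_parent assms by blast
    then show ?thesis using deg_nonroot by simp
  qed
  then show "card (out_edges k) \<le> deg T k" "deg T k \<le> Suc (card (out_edges k))" by auto
qed

text \<open>An edge is determined by its head, and every vertex except the root is a head.\<close>

lemma card_directed_tree: "card (directed_tree T r) = card (pverts T) - 1"
proof -
  have "card (snd ` directed_tree T r) = card (pverts T) - 1"
    by (simp add: snd_directed_tree root_in)
  then show ?thesis by (simp add: card_image inj_on_snd_directed_tree)
qed

text \<open>A vertex has at most one neighbour that is not a child, so each summand is at most 2
  plus the number of children; the sets of outgoing edges are disjoint, so the children total at
  most the number of vertices.\<close>

lemma sum_deg: "(\<Sum>k\<in>pverts T. 1 + deg T k) \<le> 3 * card (pverts T)"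
proof -
  have "(\<Sum>k\<in>pverts T. card (out_edges k)) = card (\<Union>k\<in>pverts T. out_edges k)"
    by (rule card_UN_disjoint[symmetric]) (auto simp: pair_finite_verts finite_directed_tree)
  also have "\<dots> \<le> card (directed_tree T r)"
    by (rule card_mono) (auto simp: finite_directed_tree)
  finally have *: "(\<Sum>k\<in>pverts T. card (out_edges k)) \<le> card (pverts T)"
    by (simp add: card_directed_tree)
  have "(\<Sum>k\<in>pverts T. 1 + deg T k) \<le> (\<Sum>k\<in>pverts T. 2 + card (out_edges k))"
    by (rule sum_mono) (use deg_bounds(2) in simp)
  also have "\<dots> \<le> 3 * card (pverts T)" using * by (subst sum.distrib) simp
  finally show ?thesis .
qed

end

lemma undirected_tree_rooted:
  assumes "undirected_tree T" "r \<in> pverts T"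
  shows "rooted_tree T r"
proof (rule rooted_tree.intro)
  show "pair_graph T" using assms(1) by (simp add: undirected_tree_def)
  show "rooted_tree_axioms T r"
    using assms unfolding undirected_tree_def rooted_tree_axioms_def by (meson not_le)
qed

section \<open>Runs of the algorithm\<close>

lemma dtree_set_label [simp]: "dtree (set_label e m s) = dtree s"
  and phase_of_set_label [simp]: "phase_of (set_label e m s) = phase_of s"
  and label_set_label [simp]: "label (set_label e m s) = (label s)(e := Some m)"
  and sol_set_label [simp]: "sol (set_label e m s) = sol s"
  and unscanned_set_label [simp]: "unscanned (set_label e m s) = unscanned s"
  and pending_set_label [simp]:
    "pending (set_label e m s) = (pending s)(fst e := pending s (fst e) - 1)"
  by (simp_all add: set_label_def Let_def)

lemma agenda_set_label:
  "agenda (set_label (p, k) m s) =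
     agenda s - {(p, k)} \<union> (if pending s p = 1 then {e \<in> dtree s. snd e = p} else {})"
  by (simp add: set_label_def Let_def)

lemma out_value_cong:
  assumes "dtree s = dtree s'" "\<And>e. e \<in> dout s k \<Longrightarrow> label s e = label s' e"
  shows "out_value T s k = out_value T s' k"
  using assms unfolding out_value_def dout_def by (auto intro!: sum.cong)

section \<open>Invariants on labels, agenda and computed unknowns\<close>

locale rooted_nat_tree = rooted_tree T i for T :: "nat pair_pre_digraph" and i :: nat
begin

text \<open>The recursion for the labels is recorded as an equation in the current state. It
  survives later labellings because a labelled edge has all edges leaving its head labelled, so its
  \<open>out_value\<close> is final.\<close>

definition labels_ok :: "bt_state \<Rightarrow> bool" where
  "labels_ok s \<longleftrightarrow> dtree s = directed_tree T i \<and>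
     (\<forall>e m. label s e = Some m \<longrightarrow> e \<in> directed_tree T i \<and> 2 \<le> m \<and> m = out_value T s (snd e) \<and>
        (\<forall>e'\<in>out_edges (snd e). label s e' \<noteq> None)) \<and>
     (\<forall>p\<in>pverts T. pending s p = card {e \<in> out_edges p. label s e = None})"

text \<open>In the phase \<open>Pendant\<close> the agenda misses the edges into pendant vertices, which the scan finds
  by itself; the parameter \<open>P\<close> excludes them.\<close>

definition ready :: "(nat \<Rightarrow> bool) \<Rightarrow> bt_state \<Rightarrow> (nat \<times> nat) set" where
  "ready P s = {(p, k) \<in> directed_tree T i. label s (p, k) = None \<and>
     (\<forall>e\<in>out_edges k. label s e \<noteq> None) \<and> P k}"

text \<open>The existential also forces the parent of a computed vertex to be computed, so the
  computed vertices form a subtree containing the root.\<close>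

definition sol_ok :: "bt_state \<Rightarrow> bool" where
  "sol_ok s \<longleftrightarrow> sol s i = Some (inverse (out_value T s i)) \<and>
     (\<forall>k. sol s k \<noteq> None \<longrightarrow> k \<in> pverts T) \<and>
     (\<forall>(p, k)\<in>directed_tree T i. \<forall>x. sol s k = Some x \<longrightarrow>
        (\<exists>y. sol s p = Some y \<and> x = y / the (label s (p, k))))"

lemma dout_eq: "dtree s = directed_tree T i \<Longrightarrow> dout s k = out_edges k"
  by (simp add: dout_def)

lemma labels_okD:
  assumes "labels_ok s"
  shows "dtree s = directed_tree T i" "dout s k = out_edges k"
    and "label s e = Some m \<Longrightarrow> e \<in> directed_tree T i"
    and "label s e = Some m \<Longrightarrow> 2 \<le> m"
    and "label s e = Some m \<Longrightarrow> m = out_value T s (snd e)"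
    and "label s e = Some m \<Longrightarrow> e' \<in> out_edges (snd e) \<Longrightarrow> label s e' \<noteq> None"
    and "p \<in> pverts T \<Longrightarrow> pending s p = card {e \<in> out_edges p. label s e = None}"
proof -
  show "dtree s = directed_tree T i" using assms by (simp add: labels_ok_def)
  then show "dout s k = out_edges k" by (rule dout_eq)
  show "p \<in> pverts T \<Longrightarrow> pending s p = card {e \<in> out_edges p. label s e = None}"
    using assms by (simp add: labels_ok_def)
  have all: "\<forall>e m. label s e = Some m \<longrightarrow>
      e \<in> directed_tree T i \<and> 2 \<le> m \<and> m = out_value T s (snd e) \<and>
      (\<forall>e'\<in>out_edges (snd e). label s e' \<noteq> None)"
    using assms unfolding labels_ok_def by (elim conjE)
  assume "label s e = Some m"
  note * = all[THEN spec, THEN spec, THEN mp, OF this]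
  show "e \<in> directed_tree T i" "2 \<le> m" "m = out_value T s (snd e)"
    using * by - (elim conjE, assumption)+
  show "label s e' \<noteq> None" if "e' \<in> out_edges (snd e)"
    using *[THEN conjunct2, THEN conjunct2, THEN conjunct2] that by (rule bspec)
qed

lemma labels_ok_cong:
  assumes "dtree s = dtree s'" "label s = label s'" "pending s = pending s'"
  shows "labels_ok s \<longleftrightarrow> labels_ok s'"
  using assms unfolding labels_ok_def out_value_def dout_def by simp

text \<open>Reciprocals of labels are at most 1. With \<open>deg_nonroot\<close> the bound becomes
  2, the lower bound required of a label; with \<open>deg_root\<close> it becomes 1, which makes the
  value at the root positive.\<close>

lemma out_value_ge:
  assumes "labels_ok s" "\<forall>e\<in>out_edges k. label s e \<noteq> None"
  shows "real (deg T k) + 1 - real (card (out_edges k)) \<le> out_value T s k"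
proof -
  have "(\<Sum>e\<in>out_edges k. 1 / the (label s e)) \<le> (\<Sum>e\<in>out_edges k. 1)"
  proof (rule sum_mono)
    fix e assume "e \<in> out_edges k"
    then obtain m where m: "label s e = Some m" using assms(2) by blast
    then have "2 \<le> m" using labels_okD(4)[OF assms(1)] by blast
    with m show "1 / the (label s e) \<le> 1" by simp
  qed
  then show ?thesis by (simp add: out_value_def labels_okD(2)[OF assms(1)])
qed

lemma out_value_root_pos:
  assumes "labels_ok s" "\<forall>e\<in>out_edges i. label s e \<noteq> None"
  shows "0 < out_value T s i"
  using out_value_ge[OF assms] deg_root by simp

text \<open>The edge was unlabelled, so it leaves no vertex whose outgoing edges are all labelled;
  hence every value on which an earlier label depends is unchanged.\<close>

lemma labels_ok_set_label:
  assumes ok: "labels_ok s" and e: "(p, k) \<in> directed_tree T i" "label s (p, k) = None"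
    and out: "\<forall>e\<in>out_edges k. label s e \<noteq> None"
  shows "labels_ok (set_label (p, k) (out_value T s k) s)" (is "labels_ok ?s")
proof -
  note d = labels_okD[OF ok]
  have val: "out_value T ?s j = out_value T s j" if "\<forall>e\<in>out_edges j. label s e \<noteq> None" for j
    by (rule out_value_cong) (use that e d(1) in \<open>auto simp: dout_def\<close>)
  have two: "2 \<le> out_value T s k"
    using out_value_ge[OF ok out] deg_nonroot[OF e(1)] by simp
  have pend: "pending ?s q = card {e \<in> out_edges q. label ?s e = None}" if "q \<in> pverts T" for q
  proof (cases "q = p")
    case True
    have "{e \<in> out_edges p. label ?s e = None} = {e \<in> out_edges p. label s e = None} - {(p, k)}"
      by auto
    then show ?thesis using True d(7)[OF that] e by (simp add: card_Diff_singleton_if)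
  next
    case False
    then have "{e \<in> out_edges q. label ?s e = None} = {e \<in> out_edges q. label s e = None}"
      by auto
    then show ?thesis using False d(7)[OF that] by simp
  qed
  have lab: "e' \<in> directed_tree T i \<and> 2 \<le> m \<and> m = out_value T ?s (snd e') \<and>
      (\<forall>e''\<in>out_edges (snd e'). label ?s e'' \<noteq> None)" if "label ?s e' = Some m" for e' m
  proof (cases "e' = (p, k)")
    case True
    then show ?thesis using that two val[OF out] e out by simp
  next
    case False
    then have l: "label s e' = Some m" using that by simp
    have o: "\<forall>e''\<in>out_edges (snd e'). label s e'' \<noteq> None" using d(6)[OF l] by blast
    show ?thesis using d(3,4)[OF l] d(5)[OF l] val[OF o] o by simp
  qed
  show ?thesis unfolding labels_ok_def using d(1) lab pend by simp
qed

text \<open>Labelling \<open>(p, k)\<close> can only make the edge entering \<open>p\<close> ready, and does so if \<open>(p, k)\<close> was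
  the last unlabelled edge leaving \<open>p\<close>.\<close>

lemma agenda_ready_set_label:
  assumes ok: "labels_ok s" and e: "(p, k) \<in> directed_tree T i" "label s (p, k) = None"
    and out: "\<forall>e\<in>out_edges k. label s e \<noteq> None"
    and P: "\<And>q. out_edges q \<noteq> {} \<Longrightarrow> P q"
    and ag: "agenda s = ready P s"
  shows "agenda (set_label (p, k) m s) = ready P (set_label (p, k) m s)" (is "_ = ready P ?s")
proof -
  note d = labels_okD[OF ok]
  let ?U = "{e \<in> out_edges p. label s e = None}"
  have "(p, k) \<in> ?U" using e by simp
  \<comment> \<open>The counter is the size of \<open>?U\<close>, and \<open>(p, k)\<close> belongs
    to \<open>?U\<close>.\<close>
  then have "pending s p = 1 \<longleftrightarrow> ?U = {(p, k)}"
    using d(7)[OF directed_tree_verts(1)[OF e(1)]]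
    by (metis (no_types, lifting) card_1_singletonE is_singletonI is_singleton_altdef singletonD)
  also have "\<dots> \<longleftrightarrow> (\<forall>e\<in>out_edges p. label ?s e \<noteq> None)"
    using e by auto
  finally have pend: "pending s p = 1 \<longleftrightarrow> (\<forall>e\<in>out_edges p. label ?s e \<noteq> None)" .
  have Pp: "P p" by (rule P) (use e in auto)
  show ?thesis
  proof (intro equalityI subrelI)
    fix q j assume "(q, j) \<in> agenda (set_label (p, k) m s)"
    then consider "(q, j) \<in> ready P s" "(q, j) \<noteq> (p, k)"
      | "pending s p = 1" "(q, j) \<in> directed_tree T i" "j = p"
      by (auto simp: agenda_set_label ag d(1) split: if_splits)
    then show "(q, j) \<in> ready P ?s"
    proof cases
      case 1
      then show ?thesis by (auto simp: ready_def)
    next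
      case 2
      \<comment> \<open>If the edge into \<open>p\<close> were labelled, all edges leaving
        \<open>p\<close> would be, including \<open>(p, k)\<close>.\<close>
      have "label s (q, p) = None"
        using d(6)[of "(q, p)" _ "(p, k)"] e by (cases "label s (q, p)") auto
      moreover have "(q, p) \<noteq> (p, k)" using directed_tree_antisym[OF e(1)] e(1) by auto
      ultimately show ?thesis using 2 pend Pp by (auto simp: ready_def)
    qed
  next
    fix q j assume r: "(q, j) \<in> ready P ?s"
    then have qj: "(q, j) \<noteq> (p, k)" "(q, j) \<in> directed_tree T i" "label s (q, j) = None" "P j"
      by (auto simp: ready_def split: if_splits)
    show "(q, j) \<in> agenda (set_label (p, k) m s)"
    proof (cases "j = p")
      case True
      then have "pending s p = 1" using r pend by (auto simp: ready_def)
      then show ?thesis using True qj d(1) by (simp add: agenda_set_label)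
    next
      case False
      have "\<forall>e\<in>out_edges j. label s e \<noteq> None"
      proof
        fix e' assume e': "e' \<in> out_edges j"
        moreover have "\<forall>e\<in>out_edges j. label ?s e \<noteq> None"
          using r unfolding ready_def mem_Collect_eq prod.case by blast
        ultimately have "label ?s e' \<noteq> None" by blast
        moreover have "e' \<noteq> (p, k)" using e' False by auto
        ultimately show "label s e' \<noteq> None" by simp
      qed
      then have "(q, j) \<in> ready P s" using qj by (simp add: ready_def)
      then show ?thesis using qj(1) by (simp add: agenda_set_label ag)
    qed
  qed
qed

subsection \<open>Invariants of the phases\<close>

text \<open>The equations for \<open>reached\<close> and \<open>dtree\<close> are mutually recursive and loop as rewrite rules.\<close>

definition orient_inv :: "bt_state \<Rightarrow> nat \<Rightarrow> bool" where
  "orient_inv s t \<longleftrightarrow> label s = (\<lambda>_. None) \<and> sol s = (\<lambda>_. None) \<and> agenda s = {} \<and>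
     frontier s \<subseteq> reached s \<and> reached s = insert i (snd ` dtree s) \<and>
     dtree s = {e \<in> directed_tree T i. fst e \<in> reached s - frontier s} \<and>
     (\<forall>p\<in>reached s - frontier s. pending s p = card (out_edges p)) \<and>
     t \<le> card (pverts T) + (\<Sum>p\<in>reached s - frontier s. 1 + deg T p)"

text \<open>In the time bound the full sum pays for the orientation, 1 for its end, and the last
  term for one step per edge scanned so far.\<close>

definition pendant_inv :: "bt_state \<Rightarrow> nat \<Rightarrow> bool" where
  "pendant_inv s t \<longleftrightarrow> labels_ok s \<and> sol s = (\<lambda>_. None) \<and> unscanned s \<subseteq> directed_tree T i \<and>
     (\<forall>e\<in>unscanned s. label s e = None) \<and>
     (\<forall>e\<in>directed_tree T i - unscanned s. out_edges (snd e) = {} \<longrightarrow> label s e \<noteq> None) \<and>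
     agenda s = ready (\<lambda>k. out_edges k \<noteq> {}) s \<and>
     t \<le> card (pverts T) + (\<Sum>p\<in>pverts T. 1 + deg T p) + 1 + card (directed_tree T i - unscanned s)"

text \<open>A labelled edge is charged to its head, whose degree bounds the number of terms in
  \<open>out_value\<close>. The fixed part covers the start, the orientation, the scan and two phase
  changes.\<close>

definition inner_inv :: "bt_state \<Rightarrow> nat \<Rightarrow> bool" where
  "inner_inv s t \<longleftrightarrow> labels_ok s \<and> sol s = (\<lambda>_. None) \<and> agenda s = ready (\<lambda>_. True) s \<and>
     t \<le> 2 * card (pverts T) + (\<Sum>p\<in>pverts T. 1 + deg T p) + 2 +
       (\<Sum>e\<in>{e \<in> directed_tree T i. label s e \<noteq> None}. 1 + deg T (snd e))"

text \<open>The second full sum pays for all labels, since the heads of the edges are distinct; the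
  last sum charges each computed unknown to its vertex.\<close>

definition solve_inv :: "bt_state \<Rightarrow> nat \<Rightarrow> bool" where
  "solve_inv s t \<longleftrightarrow> labels_ok s \<and> (\<forall>e\<in>directed_tree T i. label s e \<noteq> None) \<and> sol_ok s \<and>
     agenda s = {(p, k) \<in> directed_tree T i. sol s p \<noteq> None \<and> sol s k = None} \<and>
     t \<le> 2 * card (pverts T) + 2 * (\<Sum>p\<in>pverts T. 1 + deg T p) + 2 +
       (\<Sum>k\<in>{k \<in> pverts T. sol s k \<noteq> None}. 1 + deg T k)"

definition done_inv :: "bt_state \<Rightarrow> nat \<Rightarrow> bool" where
  "done_inv s t \<longleftrightarrow> labels_ok s \<and> (\<forall>e\<in>directed_tree T i. label s e \<noteq> None) \<and> sol_ok s \<and>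
     (\<forall>k\<in>pverts T. sol s k \<noteq> None) \<and>
     t \<le> 2 * card (pverts T) + 3 * (\<Sum>p\<in>pverts T. 1 + deg T p) + 3"

definition invariant :: "bt_state \<Rightarrow> nat \<Rightarrow> bool" where
  "invariant s t \<longleftrightarrow> (case phase_of s of Orient \<Rightarrow> orient_inv s t | Pendant \<Rightarrow> pendant_inv s t
     | Inner \<Rightarrow> inner_inv s t | Solve \<Rightarrow> solve_inv s t | Done \<Rightarrow> done_inv s t)"

section \<open>Preservation of the invariants, phase by phase\<close>

lemma orient_inv_init: "orient_inv (init_state i) (card (pverts T))"
  by (auto simp: orient_inv_def init_state_def)

text \<open>The set \<open>new\<close> consists of the children of \<open>p\<close>. Every other
  neighbour is the parent of \<open>p\<close>, which is reached because \<open>p\<close> was found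
  from it; a child of \<open>p\<close> can only be found from \<open>p\<close>, which was still in
  the frontier.\<close>

lemma orient_inv_step:
  assumes inv: "orient_inv s t" and p: "p \<in> frontier s"
    and new: "new = {k. (p, k) \<in> parcs T \<and> k \<notin> reached s}"
  shows "orient_inv (s\<lparr> dtree := dtree s \<union> {p} \<times> new, reached := reached s \<union> new,
           frontier := (frontier s - {p}) \<union> new, pending := (pending s)(p := card new) \<rparr>)
         (t + (1 + deg T p))" (is "orient_inv ?s _")
proof -
  have h: "frontier s \<subseteq> reached s" "reached s = insert i (snd ` dtree s)"
    "dtree s = {e \<in> directed_tree T i. fst e \<in> reached s - frontier s}"
    "\<forall>q\<in>reached s - frontier s. pending s q = card (out_edges q)"
    "t \<le> card (pverts T) + (\<Sum>p\<in>reached s - frontier s. 1 + deg T p)"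
    "label s = (\<lambda>_. None)" "sol s = (\<lambda>_. None)" "agenda s = {}"
    using inv unfolding orient_inv_def by - (elim conjE, assumption)+
  have h3: "(q, k) \<in> dtree s \<longleftrightarrow> (q, k) \<in> directed_tree T i \<and> q \<in> reached s \<and> q \<notin> frontier s" for q k
    by (subst h(3)) simp
  have h2: "k \<in> reached s \<longleftrightarrow> k = i \<or> (\<exists>q. (q, k) \<in> dtree s)" for k
    by (subst h(2)) force
  have newD: "new = snd ` out_edges p"
  proof (intro equalityI subsetI)
    fix k assume "k \<in> new"
    then have k: "(p, k) \<in> parcs T" "k \<notin> reached s" by (auto simp: new)
    have "(k, p) \<notin> directed_tree T i"
    proof
      assume kp: "(k, p) \<in> directed_tree T i"
      then have "p \<noteq> i" using root_no_parent by blast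
      moreover have "p \<in> reached s" using p h(1) by blast
      ultimately obtain q where "(q, p) \<in> dtree s" using h2 by blast
      then have "(q, p) \<in> directed_tree T i" "q \<in> reached s" using h3 by blast+
      then show False using parent_unique[OF kp] k(2) by blast
    qed
    then have "(p, k) \<in> directed_tree T i" using arc_cases[OF k(1)] by blast
    then show "k \<in> snd ` out_edges p" by force
  next
    fix k assume "k \<in> snd ` out_edges p"
    then have pk: "(p, k) \<in> directed_tree T i" by auto
    have "k \<notin> reached s"
    proof
      assume "k \<in> reached s"
      moreover have "k \<noteq> i" using pk root_no_parent by blast
      ultimately obtain q where "(q, k) \<in> dtree s" using h2 by blast
      then have "(q, k) \<in> directed_tree T i" "q \<notin> frontier s" using h3 by blast+
      then show False using parent_unique[OF pk] p by blast
    qed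
    then show "k \<in> new" using pk directed_tree_arc by (auto simp: new)
  qed
  have pn: "p \<notin> new" and rn: "reached s \<inter> new = {}" using p h(1) by (auto simp: new)
  \<comment> \<open>The scanned vertices are \<open>reached\<close> minus \<open>frontier\<close>;
    all new vertices enter both sets, so only \<open>p\<close> is added.\<close>
  have rf: "(reached s \<union> new) - (frontier s - {p} \<union> new) = insert p (reached s - frontier s)"
    using p pn rn h(1) by auto
  have pnew: "{p} \<times> new = out_edges p" unfolding newD by force
  have fin: "finite (reached s - frontier s)"
  proof -
    have "finite (dtree s)" using finite_directed_tree by (subst h(3)) simp
    then show ?thesis by (subst h(2)) simp
  qed
  show ?thesis
    unfolding orient_inv_def
  proof (intro conjI)
    show "label ?s = (\<lambda>_. None)" "sol ?s = (\<lambda>_. None)" "agenda ?s = {}"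
      using h(6-8) by simp_all
    show "frontier ?s \<subseteq> reached ?s" using h(1) by auto
    have "reached s \<union> new = insert i (snd ` (dtree s \<union> {p} \<times> new))"
      by (subst h(2)) (auto simp: newD pnew image_Un)
    then show "reached ?s = insert i (snd ` dtree ?s)" by simp
    have "dtree s \<union> {p} \<times> new = {e \<in> directed_tree T i. fst e \<in> insert p (reached s - frontier s)}"
      unfolding pnew by (subst h(3)) auto
    then show "dtree ?s = {e \<in> directed_tree T i. fst e \<in> reached ?s - frontier ?s}"
      by (simp add: rf)
    have "card new = card (out_edges p)"
      unfolding newD by (rule card_image[OF inj_on_snd_out_edges])
    then show "\<forall>q\<in>reached ?s - frontier ?s. pending ?s q = card (out_edges q)"
      using h(4) by (simp add: rf)
    show "t + (1 + deg T p) \<le> card (pverts T) + (\<Sum>q\<in>reached ?s - frontier ?s. 1 + deg T q)"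
      using h(5) fin p by (simp add: rf)
  qed
qed

text \<open>With an empty frontier the reached set contains the root and is closed under taking
  children, so induction on the depth shows that it contains all vertices.\<close>

lemma orient_inv_end:
  assumes inv: "orient_inv s t" and fr: "frontier s = {}"
  shows "pendant_inv (s\<lparr> phase_of := Pendant, unscanned := dtree s \<rparr>) (t + 1)"
proof -
  have h: "label s = (\<lambda>_. None)" "sol s = (\<lambda>_. None)" "agenda s = {}"
    "reached s = insert i (snd ` dtree s)"
    "dtree s = {e \<in> directed_tree T i. fst e \<in> reached s}"
    "\<forall>q\<in>reached s. pending s q = card (out_edges q)"
    "t \<le> card (pverts T) + (\<Sum>p\<in>reached s. 1 + deg T p)"
    using inv unfolding orient_inv_def fr Diff_empty by - (elim conjE, assumption)+
  have "k \<in> reached s" if "k \<in> pverts T" for k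
    using that
  proof (induction "depth k" arbitrary: k)
    case 0
    have "k = i"
    proof (rule ccontr)
      assume "k \<noteq> i"
      then obtain p where "(p, k) \<in> directed_tree T i" using ex_parent 0 by blast
      then show False using depth_directed_tree 0 by fastforce
    qed
    then show ?case by (subst h(4)) simp
  next
    case (Suc d)
    show ?case
    proof (cases "k = i")
      case False
      then obtain p where p: "(p, k) \<in> directed_tree T i" using ex_parent Suc.prems by blast
      then have "p \<in> reached s"
        using Suc.hyps depth_directed_tree[OF p] directed_tree_verts[OF p] by simp
      with p have "(p, k) \<in> dtree s" by (subst h(5)) simp
      then show ?thesis by (subst h(4)) force
    qed (subst h(4), simp)
  qed
  moreover have "reached s \<subseteq> pverts T"
  proof
    fix k assume "k \<in> reached s"
    then have "k = i \<or> k \<in> snd ` dtree s" by (subst (asm) h(4)) simp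
    moreover have "dtree s \<subseteq> directed_tree T i" by (subst h(5)) auto
    ultimately show "k \<in> pverts T" using root_in directed_tree_verts by auto
  qed
  ultimately have r: "reached s = pverts T" by blast
  have d: "dtree s = directed_tree T i"
    by (subst h(5)) (auto simp: r directed_tree_verts)
  show ?thesis
    \<comment> \<open>Nothing is labelled yet, so an edge could be ready only if its head had no
      children, which the predicate excludes; the empty agenda is therefore exact.\<close>
    unfolding pendant_inv_def labels_ok_def ready_def using h(1-3,6,7) by (auto simp: r d)
qed

lemma pendant_inv_label:
  assumes inv: "pendant_inv s t" and e: "(p, k) \<in> unscanned s" and k: "deg T k = 1"
  shows "pendant_inv (set_label (p, k) 2 (s\<lparr> unscanned := unscanned s - {(p, k)} \<rparr>)) (t + 1)"
    (is "pendant_inv (set_label _ _ ?s) _")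
proof -
  have h: "labels_ok s" "sol s = (\<lambda>_. None)" "unscanned s \<subseteq> directed_tree T i"
    "\<forall>e\<in>unscanned s. label s e = None"
    "\<forall>e\<in>directed_tree T i - unscanned s. out_edges (snd e) = {} \<longrightarrow> label s e \<noteq> None"
    "agenda s = ready (\<lambda>k. out_edges k \<noteq> {}) s"
    "t \<le> card (pverts T) + (\<Sum>p\<in>pverts T. 1 + deg T p) + 1 + card (directed_tree T i - unscanned s)"
    using inv by (simp_all add: pendant_inv_def)
  have pk: "(p, k) \<in> directed_tree T i" "label ?s (p, k) = None" using h e by auto
  have ok: "labels_ok ?s" using h(1) labels_ok_cong[of ?s s] by simp
  have "card (out_edges k) = 0" using deg_nonroot[OF pk(1)] k by simp
  then have none: "out_edges k = {}" using finite_directed_tree by simp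
  \<comment> \<open>The prescribed 2 is the recursion at a leaf: \<open>1 + 1\<close> minus an empty
    sum. So the general labelling lemmas apply here too.\<close>
  then have val: "out_value T ?s k = 2" using k unfolding out_value_def labels_okD(2)[OF ok] none by simp
  have out: "\<forall>e\<in>out_edges k. label ?s e \<noteq> None" unfolding none by simp
  have "agenda ?s = ready (\<lambda>k. out_edges k \<noteq> {}) ?s" using h(6) by (simp add: ready_def)
  from agenda_ready_set_label[OF ok pk out _ this, of 2]
  have ag: "agenda (set_label (p, k) 2 ?s) =
    ready (\<lambda>k. out_edges k \<noteq> {}) (set_label (p, k) 2 ?s)" by simp
  have "directed_tree T i - (unscanned s - {(p, k)}) =
      insert (p, k) (directed_tree T i - unscanned s)"
    using pk by auto
  then have c: "card (directed_tree T i - (unscanned s - {(p, k)})) =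
      Suc (card (directed_tree T i - unscanned s))"
    using e finite_directed_tree by simp
  show ?thesis
    unfolding pendant_inv_def using labels_ok_set_label[OF ok pk out] ag h(2-5,7)
    by (auto simp: val c)
qed

text \<open>The head of an edge is never the root, so a skipped edge has a head of degree other than
  1, hence with children; the demand on scanned leaf edges does not concern it.\<close>

lemma pendant_inv_skip:
  assumes inv: "pendant_inv s t" and e: "(p, k) \<in> unscanned s" and k: "\<not> (k \<noteq> i \<and> deg T k = 1)"
  shows "pendant_inv (s\<lparr> unscanned := unscanned s - {(p, k)} \<rparr>) (t + 1)" (is "pendant_inv ?s _")
proof -
  have h: "labels_ok s" "unscanned s \<subseteq> directed_tree T i"
    "t \<le> card (pverts T) + (\<Sum>p\<in>pverts T. 1 + deg T p) + 1 + card (directed_tree T i - unscanned s)"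
    using inv by (simp_all add: pendant_inv_def)
  have pk: "(p, k) \<in> directed_tree T i" using h e by auto
  have ok: "labels_ok ?s" using h(1) labels_ok_cong[of ?s s] by simp
  have "k \<noteq> i" using pk root_no_parent by blast
  with k have "card (out_edges k) \<noteq> 0" using deg_nonroot[OF pk] by simp
  then have some: "out_edges k \<noteq> {}" by (metis card.empty)
  have "directed_tree T i - (unscanned s - {(p, k)}) =
      insert (p, k) (directed_tree T i - unscanned s)"
    using pk by auto
  then have c: "card (directed_tree T i - (unscanned s - {(p, k)})) =
      Suc (card (directed_tree T i - unscanned s))"
    using e finite_directed_tree by simp
  show ?thesis
    using inv ok some unfolding pendant_inv_def ready_def by (auto simp: c)
qed

lemma pendant_inv_end:
  assumes inv: "pendant_inv s t" and un: "unscanned s = {}"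
  shows "inner_inv (s\<lparr> phase_of := Inner \<rparr>) (t + 1)" (is "inner_inv ?s _")
proof -
  have h: "labels_ok s" "\<forall>e\<in>directed_tree T i. out_edges (snd e) = {} \<longrightarrow> label s e \<noteq> None"
    "t \<le> card (pverts T) + (\<Sum>p\<in>pverts T. 1 + deg T p) + 1 + card (directed_tree T i)"
    "sol s = (\<lambda>_. None)" "agenda s = ready (\<lambda>k. out_edges k \<noteq> {}) s"
    using inv un by (simp_all add: pendant_inv_def)
  have ok: "labels_ok ?s" using h(1) labels_ok_cong[of ?s s] by simp
  \<comment> \<open>All leaf edges are labelled after the scan, so excluding them no longer removes
    anything.\<close>
  have "ready (\<lambda>k. out_edges k \<noteq> {}) s = ready (\<lambda>_. True) ?s"
    using h(2) by (fastforce simp: ready_def)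
  then show ?thesis
    unfolding inner_inv_def using h(3-5) ok card_directed_tree by simp
qed

lemma inner_inv_label:
  assumes inv: "inner_inv s t" and pk: "(p, k) \<in> dtree s" "label s (p, k) = None"
    and out: "\<forall>e \<in> dout s k. label s e \<noteq> None"
  shows "inner_inv (set_label (p, k) (out_value T s k) s) (t + (1 + card (dout s k)))"
    (is "inner_inv ?s _")
proof -
  have h: "labels_ok s" "sol s = (\<lambda>_. None)" "agenda s = ready (\<lambda>_. True) s"
    "t \<le> 2 * card (pverts T) + (\<Sum>p\<in>pverts T. 1 + deg T p) + 2 +
       (\<Sum>e\<in>{e \<in> directed_tree T i. label s e \<noteq> None}. 1 + deg T (snd e))"
    using inv by (simp_all add: inner_inv_def)
  note d = labels_okD(1,2)[OF h(1)]
  have pk': "(p, k) \<in> directed_tree T i" and out': "\<forall>e\<in>out_edges k. label s e \<noteq> None"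
    using pk out d by simp_all
  have s: "{e \<in> directed_tree T i. label ?s e \<noteq> None} =
      insert (p, k) {e \<in> directed_tree T i. label s e \<noteq> None}"
    using pk' by auto
  have "card (out_edges k) \<le> deg T k" using deg_bounds directed_tree_verts[OF pk'] by blast
  moreover have "(\<Sum>e\<in>insert (p, k) {e \<in> directed_tree T i. label s e \<noteq> None}. 1 + deg T (snd e)) =
      1 + deg T k + (\<Sum>e\<in>{e \<in> directed_tree T i. label s e \<noteq> None}. 1 + deg T (snd e))"
    using finite_directed_tree pk(2) by simp
  ultimately have "t + (1 + card (dout s k)) \<le> 2 * card (pverts T) + (\<Sum>p\<in>pverts T. 1 + deg T p) + 2 +
       (\<Sum>e\<in>{e \<in> directed_tree T i. label ?s e \<noteq> None}. 1 + deg T (snd e))"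
    unfolding s d(2) using h(4) by linarith
  moreover have "agenda ?s = ready (\<lambda>_. True) ?s"
    using agenda_ready_set_label[OF h(1) pk' pk(2) out' _ h(3)] by simp
  ultimately show ?thesis
    unfolding inner_inv_def using labels_ok_set_label[OF h(1) pk' pk(2) out'] h(2) by simp
qed

text \<open>Once every edge is labelled the agenda is empty, so the edges leaving the root are all
  that it holds afterwards.\<close>

lemma inner_inv_root:
  assumes inv: "inner_inv s t" and all: "\<forall>e \<in> dtree s. label s e \<noteq> None"
  shows "solve_inv (s\<lparr> phase_of := Solve, sol := (sol s)(i := Some (inverse (out_value T s i))),
           agenda := agenda s \<union> dout s i \<rparr>) (t + (1 + card (dout s i)))" (is "solve_inv ?s _")
proof -
  have h: "labels_ok s" "sol s = (\<lambda>_. None)" "agenda s = ready (\<lambda>_. True) s"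
    "t \<le> 2 * card (pverts T) + (\<Sum>p\<in>pverts T. 1 + deg T p) + 2 +
       (\<Sum>e\<in>{e \<in> directed_tree T i. label s e \<noteq> None}. 1 + deg T (snd e))"
    using inv by (simp_all add: inner_inv_def)
  note d = labels_okD(1,2)[OF h(1)]
  have ok: "labels_ok ?s" using h(1) labels_ok_cong[of ?s s] by simp
  have all': "\<forall>e\<in>directed_tree T i. label s e \<noteq> None" using all d by simp
  have "ready (\<lambda>_. True) s = {}" using all' by (auto simp: ready_def)
  then have ag: "agenda ?s = {(p, k) \<in> directed_tree T i. sol ?s p \<noteq> None \<and> sol ?s k = None}"
    using h(2,3) d root_no_parent by (auto split: if_splits)
  have val: "out_value T ?s i = out_value T s i" by (rule out_value_cong) auto
  have so: "sol_ok ?s" unfolding sol_ok_def val using h(2) root_in root_no_parent by auto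
  have "{e \<in> directed_tree T i. label s e \<noteq> None} = directed_tree T i" using all' by auto
  moreover have "(\<Sum>e\<in>directed_tree T i. 1 + deg T (snd e)) = (\<Sum>k\<in>snd ` directed_tree T i. 1 + deg T k)"
    by (rule sum.reindex_cong[OF inj_on_snd_directed_tree, symmetric]) auto
  moreover have "(\<Sum>k\<in>snd ` directed_tree T i. 1 + deg T k) \<le> (\<Sum>k\<in>pverts T. 1 + deg T k)"
    by (rule sum_mono2) (auto simp: pair_finite_verts snd_directed_tree)
  \<comment> \<open>The cost of this step, \<open>1 + deg T i\<close> by \<open>deg_root\<close>, is
    exactly the summand of the only computed vertex.\<close>
  moreover have "{k \<in> pverts T. sol ?s k \<noteq> None} = {i}" using h(2) root_in by auto
  ultimately have "t + (1 + card (dout s i)) \<le> 2 * card (pverts T) + 2 * (\<Sum>p\<in>pverts T. 1 + deg T p) + 2 +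
       (\<Sum>k\<in>{k \<in> pverts T. sol ?s k \<noteq> None}. 1 + deg T k)"
    using h(4) d(2) deg_root by simp
  then show ?thesis unfolding solve_inv_def using ok all' so ag by simp
qed

text \<open>Only one edge enters \<open>k\<close>, so no edge but \<open>(p, k)\<close> has to leave
  the agenda; the edges leaving \<open>k\<close> have to enter it because no child of an uncomputed
  vertex is computed.\<close>

lemma solve_inv_step:
  assumes inv: "solve_inv s t" and pk: "(p, k) \<in> dtree s" and x: "sol s p = Some xp" "sol s k = None"
  shows "solve_inv (s\<lparr> sol := (sol s)(k := Some (xp / the (label s (p, k)))),
           agenda := (agenda s - {(p, k)}) \<union> dout s k \<rparr>) (t + (1 + card (dout s k)))" (is "solve_inv ?s _")
proof -
  have h: "labels_ok s" "\<forall>e\<in>directed_tree T i. label s e \<noteq> None" "sol_ok s"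
    "agenda s = {(p, k) \<in> directed_tree T i. sol s p \<noteq> None \<and> sol s k = None}"
    "t \<le> 2 * card (pverts T) + 2 * (\<Sum>p\<in>pverts T. 1 + deg T p) + 2 +
       (\<Sum>k\<in>{k \<in> pverts T. sol s k \<noteq> None}. 1 + deg T k)"
    using inv by (simp_all add: solve_inv_def)
  note d = labels_okD(1,2)[OF h(1)]
  have ok: "labels_ok ?s" using h(1) labels_ok_cong[of ?s s] by simp
  have pk': "(p, k) \<in> directed_tree T i" using pk d by simp
  have kV: "k \<in> pverts T" using directed_tree_verts[OF pk'] by blast
  have ki: "k \<noteq> i" using pk' root_no_parent by blast
  have so: "sol s i = Some (inverse (out_value T s i))"
     "\<And>k. sol s k \<noteq> None \<Longrightarrow> k \<in> pverts T"
     "\<And>p k x. (p, k) \<in> directed_tree T i \<Longrightarrow> sol s k = Some x \<Longrightarrow>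
        \<exists>y. sol s p = Some y \<and> x = y / the (label s (p, k))"
    using h(3) unfolding sol_ok_def by blast+
  have child: "sol s j = None" if "(k, j) \<in> directed_tree T i" for j
    using so(3)[OF that] x(2) by (cases "sol s j") auto
  have ag: "agenda ?s = {(p, k) \<in> directed_tree T i. sol ?s p \<noteq> None \<and> sol ?s k = None}"
  proof (intro equalityI subrelI)
    fix q j assume "(q, j) \<in> agenda ?s"
    then consider "(q, j) \<in> agenda s" "(q, j) \<noteq> (p, k)" | "q = k" "(k, j) \<in> directed_tree T i"
      using d(2) by auto
    then show "(q, j) \<in> {(p, k) \<in> directed_tree T i. sol ?s p \<noteq> None \<and> sol ?s k = None}"
    proof cases
      case 1
      then have qj: "(q, j) \<in> directed_tree T i" "sol s q \<noteq> None" "sol s j = None"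
        using h(4) by auto
      then have "j \<noteq> k" using parent_unique[OF pk'] 1(2) by blast
      then show ?thesis using qj by simp
    next
      case 2
      then have "j \<noteq> k" using directed_tree_antisym by blast
      then show ?thesis using 2 child by simp
    qed
  next
    fix q j assume "(q, j) \<in> {(p, k) \<in> directed_tree T i. sol ?s p \<noteq> None \<and> sol ?s k = None}"
    then have qj: "(q, j) \<in> directed_tree T i" "sol ?s q \<noteq> None" "j \<noteq> k" "sol s j = None"
      by (auto split: if_splits)
    show "(q, j) \<in> agenda ?s"
    proof (cases "q = k")
      case True
      then show ?thesis using qj(1) d(2) by simp
    next
      case False
      then have "sol s q \<noteq> None" using qj(2) by simp
      then show ?thesis using qj h(4) by simp
    qed
  qed
  have val: "out_value T ?s i = out_value T s i" by (rule out_value_cong) auto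
  have "\<exists>y. sol ?s q = Some y \<and> z = y / the (label ?s (q, j))"
    if qj: "(q, j) \<in> directed_tree T i" and z: "sol ?s j = Some z" for q j z
  proof (cases "j = k")
    case True
    then have "q = p" using parent_unique qj pk' by blast
    moreover have "p \<noteq> k" using x by auto
    ultimately show ?thesis using True z x by simp
  next
    case False
    then have "sol s j = Some z" using z by simp
    \<comment> \<open>The parent \<open>q\<close> is already computed and thus differs from
      \<open>k\<close>, so the update keeps its value.\<close>
    from so(3)[OF qj this] show ?thesis using x by auto
  qed
  then have so': "sol_ok ?s" unfolding sol_ok_def val using so(1,2) ki kV by auto
  have "{k \<in> pverts T. sol ?s k \<noteq> None} = insert k {k \<in> pverts T. sol s k \<noteq> None}"
    using kV by auto
  then have sum: "(\<Sum>k\<in>{k \<in> pverts T. sol ?s k \<noteq> None}. 1 + deg T k) =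
      1 + deg T k + (\<Sum>k\<in>{k \<in> pverts T. sol s k \<noteq> None}. 1 + deg T k)"
    using pair_finite_verts x(2) by simp
  have "card (out_edges k) \<le> deg T k" using deg_bounds kV by blast
  then have "t + (1 + card (dout s k)) \<le> 2 * card (pverts T) + 2 * (\<Sum>p\<in>pverts T. 1 + deg T p) + 2 +
       (\<Sum>k\<in>{k \<in> pverts T. sol ?s k \<noteq> None}. 1 + deg T k)"
    unfolding sum unfolding d(2) using h(5) by linarith
  then show ?thesis unfolding solve_inv_def using ok h(2) so' ag by simp
qed

lemma solve_inv_end:
  assumes inv: "solve_inv s t" and all: "\<forall>k \<in> pverts T. sol s k \<noteq> None"
  shows "done_inv (s\<lparr> phase_of := Done \<rparr>) (t + 1)" (is "done_inv ?s _")
proof -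
  have ok: "labels_ok ?s" using inv labels_ok_cong[of ?s s] by (simp add: solve_inv_def)
  have val: "out_value T ?s i = out_value T s i" by (rule out_value_cong) auto
  have so: "sol_ok ?s" using inv unfolding solve_inv_def sol_ok_def val by simp
  have "{k \<in> pverts T. sol s k \<noteq> None} = pverts T" using all by auto
  then show ?thesis using inv ok so all unfolding done_inv_def solve_inv_def by simp
qed

lemma invariant_step:
  assumes "bt_step T i s c s'" "invariant s t"
  shows "invariant s' (t + c)"
  using assms
proof (induction rule: bt_step.induct)
  case (orient s p new)
  then show ?case using orient_inv_step[of s t p new] by (simp add: invariant_def)
next
  case (orient_end s)
  then show ?case using orient_inv_end[of s t] by (simp add: invariant_def)
next
  case (pendant_label s p k)
  then show ?case using pendant_inv_label[of s t p k] by (simp add: invariant_def)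
next
  case (pendant_skip s p k)
  then show ?case using pendant_inv_skip[of s t p k] by (simp add: invariant_def)
next
  case (pendant_end s)
  then show ?case using pendant_inv_end[of s t] by (simp add: invariant_def)
next
  case (inner_label s p k)
  then show ?case using inner_inv_label[of s t p k] by (simp add: invariant_def)
next
  case (root s)
  then show ?case using inner_inv_root[of s t] by (simp add: invariant_def)
next
  case (solve s p k xp)
  then show ?case using solve_inv_step[of s t p k xp] by (simp add: invariant_def)
next
  case (solve_end s)
  then show ?case using solve_inv_end[of s t] by (simp add: invariant_def)
qed

lemma bt_run_invariant: "bt_run T i s t \<Longrightarrow> invariant s t"
proof (induction rule: bt_run.induct)
  case start
  then show ?case using orient_inv_init by (simp add: invariant_def init_state_def)
qed (rule invariant_step)

subsection \<open>Cost, progress and termination\<close>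

text \<open>Every partial sum in the phase bounds is at most the full sum \<open>?W\<close>, and
  \<open>?W \<le> 3 * ?n\<close> by \<open>sum_deg\<close>; the factor 11 is 2 + 3 * 3.\<close>

lemma invariant_time:
  assumes "invariant s t"
  shows "t \<le> 11 * card (pverts T) + 3"
proof -
  let ?W = "\<Sum>p\<in>pverts T. 1 + deg T p" and ?n = "card (pverts T)"
  have sub: "(\<Sum>p\<in>A. 1 + deg T p) \<le> ?W" if "A \<subseteq> pverts T" for A
    using that by (intro sum_mono2) (auto simp: pair_finite_verts)
  have sub_edges: "(\<Sum>e\<in>A. 1 + deg T (snd e)) \<le> ?W" if "A \<subseteq> directed_tree T i" for A
  proof -
    have "(\<Sum>e\<in>A. 1 + deg T (snd e)) = (\<Sum>k\<in>snd ` A. 1 + deg T k)"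
      using inj_on_subset[OF inj_on_snd_directed_tree that]
      by (intro sum.reindex_cong[symmetric]) auto
    also have "\<dots> \<le> ?W" using that directed_tree_verts by (intro sub) auto
    finally show ?thesis .
  qed
  have edges: "card (directed_tree T i - A) \<le> ?n" for A
    using card_mono[OF finite_directed_tree, of "directed_tree T i - A"] card_directed_tree by simp
  have "t \<le> 2 * ?n + 3 * ?W + 3"
  proof (cases "phase_of s")
    case Orient
    then have inv: "orient_inv s t" using assms by (simp add: invariant_def)
    have h: "reached s = insert i (snd ` dtree s)"
      "dtree s = {e \<in> directed_tree T i. fst e \<in> reached s - frontier s}"
      "t \<le> ?n + (\<Sum>p\<in>reached s - frontier s. 1 + deg T p)"
      using inv unfolding orient_inv_def by - (elim conjE, assumption)+
    have "dtree s \<subseteq> directed_tree T i" by (subst h(2)) auto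
    then have "reached s \<subseteq> pverts T"
      by (subst h(1)) (use root_in directed_tree_verts in auto)
    then have "(\<Sum>p\<in>reached s - frontier s. 1 + deg T p) \<le> ?W" by (intro sub) auto
    with h(3) show ?thesis by linarith
  next
    case Pendant
    then have "t \<le> ?n + ?W + 1 + card (directed_tree T i - unscanned s)"
      using assms by (simp add: invariant_def pendant_inv_def)
    with edges[of "unscanned s"] show ?thesis by linarith
  next
    case Inner
    then have "t \<le> 2 * ?n + ?W + 2 + (\<Sum>e\<in>{e \<in> directed_tree T i. label s e \<noteq> None}. 1 + deg T (snd e))"
      using assms by (simp add: invariant_def inner_inv_def)
    moreover have "(\<Sum>e\<in>{e \<in> directed_tree T i. label s e \<noteq> None}. 1 + deg T (snd e)) \<le> ?W"
      by (rule sub_edges) auto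
    ultimately show ?thesis by linarith
  next
    case Solve
    then have "t \<le> 2 * ?n + 2 * ?W + 2 + (\<Sum>k\<in>{k \<in> pverts T. sol s k \<noteq> None}. 1 + deg T k)"
      using assms by (simp add: invariant_def solve_inv_def)
    moreover have "(\<Sum>k\<in>{k \<in> pverts T. sol s k \<noteq> None}. 1 + deg T k) \<le> ?W"
      by (rule sub) auto
    ultimately show ?thesis by linarith
  next
    case Done
    then show ?thesis using assms by (simp add: invariant_def done_inv_def)
  qed
  with sum_deg show ?thesis by linarith
qed

text \<open>Take an unlabelled edge whose head has maximal depth: the edges leaving that head end
  deeper and so are labelled.\<close>

lemma ex_ready_edge:
  assumes "e \<in> directed_tree T i" "label s e = None"
  shows "\<exists>p k. (p, k) \<in> directed_tree T i \<and> label s (p, k) = None \<and> (\<forall>e\<in>out_edges k. label s e \<noteq> None)"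
proof -
  let ?U = "{e \<in> directed_tree T i. label s e = None}"
  let ?d = "\<lambda>e. depth (snd e)"
  have fin: "finite (?d ` ?U)" using finite_directed_tree by simp
  have "?d ` ?U \<noteq> {}" using assms by blast
  then obtain p k where pk: "(p, k) \<in> ?U" "depth k = Max (?d ` ?U)"
    using Max_in[OF fin] by force
  have "label s e \<noteq> None" if "e \<in> out_edges k" for e
  proof
    assume "label s e = None"
    then have "?d e \<le> depth k" using that pk(2) fin by simp
    moreover have "?d e = Suc (depth k)" using that depth_directed_tree by (cases e) auto
    ultimately show False by simp
  qed
  with pk(1) show ?thesis by blast
qed

text \<open>Climb from the uncomputed vertex towards the root, which is computed; somewhere an
  uncomputed vertex has a computed parent.\<close>

lemma ex_solvable_edge:
  assumes "sol_ok s" "k \<in> pverts T" "sol s k = None"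
  shows "\<exists>p k xp. (p, k) \<in> directed_tree T i \<and> sol s p = Some xp \<and> sol s k = None"
  using assms(2,3)
proof (induction "depth k" arbitrary: k rule: less_induct)
  case less
  have "sol s i \<noteq> None" using assms(1) by (simp add: sol_ok_def)
  then have "k \<noteq> i" using less.prems by blast
  then obtain p where p: "(p, k) \<in> directed_tree T i" using ex_parent less.prems(1) by blast
  show ?case
  proof (cases "sol s p")
    case None
    then show ?thesis
      using less.hyps[of p] depth_directed_tree[OF p] directed_tree_verts(1)[OF p] by simp
  next
    case (Some xp)
    then show ?thesis using p less.prems by blast
  qed
qed

lemma invariant_progress:
  assumes inv: "invariant s t" and "phase_of s \<noteq> Done"
  shows "\<exists>c s'. bt_step T i s c s'"
proof (cases "phase_of s")
  case Orient
  then show ?thesis using bt_step.orient bt_step.orient_end by (cases "frontier s = {}") blast+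
next
  case Pendant
  show ?thesis
  proof (cases "unscanned s = {}")
    case True
    then show ?thesis using bt_step.pendant_end[OF Pendant] by blast
  next
    case False
    then obtain p k where pk: "(p, k) \<in> unscanned s" by fast
    show ?thesis
    proof (cases "k \<noteq> i \<and> deg T k = 1")
      case True
      then show ?thesis using bt_step.pendant_label[OF Pendant pk] by blast
    next
      case False
      then show ?thesis using bt_step.pendant_skip[OF Pendant pk] by blast
    qed
  qed
next
  case Inner
  then have d: "dtree s = directed_tree T i" "\<And>k. dout s k = out_edges k"
    using inv labels_okD(1,2) by (auto simp: invariant_def inner_inv_def)
  show ?thesis
  proof (cases "\<forall>e\<in>dtree s. label s e \<noteq> None")
    case True
    then show ?thesis using bt_step.root[OF Inner] by blast
  next
    case False
    then obtain e where "e \<in> directed_tree T i" "label s e = None" using d(1) by blast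
    from ex_ready_edge[OF this]
    obtain p k where "(p, k) \<in> dtree s" "label s (p, k) = None" "\<forall>e\<in>dout s k. label s e \<noteq> None"
      unfolding d by blast
    then show ?thesis using bt_step.inner_label[OF Inner] by blast
  qed
next
  case Solve
  then have d: "dtree s = directed_tree T i" and so: "sol_ok s"
    using inv labels_okD(1) by (auto simp: invariant_def solve_inv_def)
  show ?thesis
  proof (cases "\<forall>k\<in>pverts T. sol s k \<noteq> None")
    case True
    then show ?thesis using bt_step.solve_end[OF Solve] by blast
  next
    case False
    then obtain k where "k \<in> pverts T" "sol s k = None" by blast
    from ex_solvable_edge[OF so this]
    obtain p k xp where "(p, k) \<in> dtree s" "sol s p = Some xp" "sol s k = None" using d by blast
    then show ?thesis using bt_step.solve[OF Solve] by blast
  qed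
qed (use assms in simp)

section \<open>Sound divisions and exact agendas\<close>

lemma invariant_labels_ok: "invariant s t \<Longrightarrow> phase_of s \<noteq> Orient \<Longrightarrow> labels_ok s"
  by (cases "phase_of s")
    (auto simp: invariant_def pendant_inv_def inner_inv_def solve_inv_def done_inv_def)

text \<open>Division by 0 yields 0 in HOL; this shows that no division by a label relies on that
  convention.\<close>

lemma invariant_label_nonzero:
  assumes inv: "invariant s t" and l: "label s e = Some m"
  shows "m \<noteq> 0"
proof (cases "phase_of s = Orient")
  case True
  then have "orient_inv s t" using inv by (simp add: invariant_def)
  then have "label s = (\<lambda>_. None)" unfolding orient_inv_def by (elim conjE)
  with l show ?thesis by simp
next
  case False
  show ?thesis using labels_okD(4)[OF invariant_labels_ok[OF inv False] l] by simp
qed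

lemma invariant_agenda_exact:
  assumes inv: "invariant s t"
  shows "agenda_exact s"
proof -
  have "agenda s = {(p, k) \<in> dtree s. label s (p, k) = None \<and> (\<forall>e \<in> dout s k. label s e \<noteq> None)}"
    if "phase_of s = Inner"
  proof -
    have "labels_ok s" "agenda s = ready (\<lambda>_. True) s"
      using inv that by (auto simp: invariant_def inner_inv_def)
    then show ?thesis using labels_okD(1,2)[of s] by (simp add: ready_def)
  qed
  moreover have "agenda s = {(p, k) \<in> dtree s. sol s p \<noteq> None \<and> sol s k = None}"
    if "phase_of s = Solve"
  proof -
    have "labels_ok s" "agenda s = {(p, k) \<in> directed_tree T i. sol s p \<noteq> None \<and> sol s k = None}"
      using inv that by (auto simp: invariant_def solve_inv_def)
    then show ?thesis using labels_okD(1)[of s] by simp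
  qed
  ultimately show ?thesis unfolding agenda_exact_def by blast
qed

section \<open>Termination and existence of complete runs\<close>

lemma bt_step_cost: "bt_step T i s c s' \<Longrightarrow> 1 \<le> c"
  by (induction rule: bt_step.induct) auto

text \<open>Each step costs at least 1, so after \<open>11 * card (pverts T) + 4\<close> steps the
  time exceeds the bound of \<open>invariant_time\<close>.\<close>

lemma bt_terminates:
  "\<nexists>\<sigma>. \<sigma> 0 = init_state i \<and> (\<forall>j. \<exists>c. bt_step T i (\<sigma> j) c (\<sigma> (Suc j)))"
proof
  assume "\<exists>\<sigma>. \<sigma> 0 = init_state i \<and> (\<forall>j. \<exists>c. bt_step T i (\<sigma> j) c (\<sigma> (Suc j)))"
  then obtain \<sigma> where \<sigma>: "\<sigma> 0 = init_state i" "\<And>j. \<exists>c. bt_step T i (\<sigma> j) c (\<sigma> (Suc j))"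
    by blast
  have run: "\<exists>t\<ge>j. bt_run T i (\<sigma> j) t" for j
  proof (induction j)
    case 0
    then show ?case using bt_run.start[of T i] \<sigma>(1) by auto
  next
    case (Suc j)
    then obtain t where t: "j \<le> t" "bt_run T i (\<sigma> j) t" by blast
    obtain c where c: "bt_step T i (\<sigma> j) c (\<sigma> (Suc j))" using \<sigma>(2) by blast
    have "Suc j \<le> t + c" using t(1) bt_step_cost[OF c] by simp
    then show ?case using bt_run.continue[OF t(2) c] by blast
  qed
  obtain t where t: "11 * card (pverts T) + 4 \<le> t" "bt_run T i (\<sigma> (11 * card (pverts T) + 4)) t"
    using run by blast
  then show False using invariant_time[OF bt_run_invariant[OF t(2)]] by simp
qed

text \<open>Steps have positive cost and runs bounded cost, so a run of maximal cost is complete.\<close>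

lemma ex_complete_run: "\<exists>s t. bt_run T i s t \<and> phase_of s = Done"
proof -
  let ?R = "{t. \<exists>s. bt_run T i s t}"
  have "?R \<subseteq> {..11 * card (pverts T) + 3}"
    using invariant_time bt_run_invariant by auto
  then have fin: "finite ?R" using finite_subset by blast
  have "?R \<noteq> {}" using bt_run.start by blast
  then have "Max ?R \<in> ?R" using fin by (intro Max_in)
  then obtain s where s: "bt_run T i s (Max ?R)" by blast
  have "phase_of s = Done"
  proof (rule ccontr)
    assume "phase_of s \<noteq> Done"
    then obtain c s' where c: "bt_step T i s c s'"
      using invariant_progress[OF bt_run_invariant[OF s]] by blast
    have "Max ?R + c \<in> ?R" using bt_run.continue[OF s c] by blast
    then have "Max ?R + c \<le> Max ?R" by (rule Max_ge[OF fin])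
    then show False using bt_step_cost[OF c] by simp
  qed
  with s show ?thesis by blast
qed

section \<open>The linear system\<close>

text \<open>Replacing each child's value by \<open>the (sol s k)\<close> over the label turns the
  diagonal term minus the children into \<open>the (sol s k) * out_value T s k\<close>. At the root
  this is 1 by the choice of the first unknown; elsewhere it is the parent's value, which the
  remaining neighbour term cancels.\<close>

lemma sol_equation:
  assumes inv: "done_inv s t" and k: "k \<in> pverts T"
  shows "(real (deg T k) + 1) * the (sol s k) - (\<Sum>j | (k, j) \<in> parcs T. the (sol s j)) =
    (if k = i then 1 else 0)"
proof -
  have ok: "labels_ok s" and lab: "\<forall>e\<in>directed_tree T i. label s e \<noteq> None" and so: "sol_ok s"
    and all: "\<forall>k\<in>pverts T. sol s k \<noteq> None"
    using inv by (auto simp: done_inv_def)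
  let ?x = "\<lambda>k. the (sol s k)" and ?l = "\<lambda>e. the (label s e)"
  have x: "?x k = ?x p / ?l (p, k)" if pk: "(p, k) \<in> directed_tree T i" for p k
  proof -
    obtain z where z: "sol s k = Some z" using all directed_tree_verts(2)[OF pk] by blast
    then show ?thesis using so pk unfolding sol_ok_def by fastforce
  qed
  let ?c = "\<Sum>e\<in>out_edges k. 1 / ?l e"
  have val: "out_value T s k = real (deg T k) + 1 - ?c"
    by (simp add: out_value_def labels_okD(2)[OF ok])
  have "(\<Sum>j\<in>snd ` out_edges k. ?x j) = (\<Sum>e\<in>out_edges k. ?x (snd e))"
    by (rule sum.reindex_cong[OF inj_on_snd_out_edges]) auto
  also have "\<dots> = (\<Sum>e\<in>out_edges k. ?x k * (1 / ?l e))"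
  proof (rule sum.cong[OF refl])
    fix e assume "e \<in> out_edges k"
    then show "?x (snd e) = ?x k * (1 / ?l e)" using x by (cases e) auto
  qed
  also have "\<dots> = ?x k * ?c" by (rule sum_distrib_left[symmetric])
  finally have children: "(\<Sum>j\<in>snd ` out_edges k. ?x j) = ?x k * ?c" .
  show ?thesis
  proof (cases "k = i")
    case True
    \<comment> \<open>Positivity allows the inverse defining the root value to be cancelled.\<close>
    have "0 < out_value T s i" using out_value_root_pos[OF ok] lab by blast
    then have "?x k * out_value T s k = 1" using so True by (simp add: sol_ok_def)
    then show ?thesis
      using children True neighbours_root by (simp add: val[unfolded True] algebra_simps)
  next
    case False
    then obtain p where p: "(p, k) \<in> directed_tree T i" using ex_parent k by blast
    then obtain m where m: "label s (p, k) = Some m" using lab by blast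
    \<comment> \<open>The label is nonzero, so the division by it can be undone.\<close>
    have "2 \<le> m" "m = out_value T s k" using labels_okD(4,5)[OF ok m] by simp_all
    then have "?x k * out_value T s k = ?x p" using x[OF p] m by simp
    moreover have "(\<Sum>j | (k, j) \<in> parcs T. ?x j) = ?x p + (\<Sum>j\<in>snd ` out_edges k. ?x j)"
      unfolding neighbours(1)[OF p] using neighbours(2)[OF p] finite_directed_tree by simp
    ultimately show ?thesis
      using False children by (simp add: val algebra_simps)
  qed
qed

lemma laplacian_mult_output:
  assumes V: "pverts T = {0..<n}" and run: "bt_run T i s t" "phase_of s = Done"
  shows "(laplacian n T + 1\<^sub>m n) *\<^sub>v bt_output n s = unit_vec n i"
proof (rule eq_vecI)
  have inv: "done_inv s t" using bt_run_invariant[OF run(1)] run(2) by (simp add: invariant_def)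
  let ?x = "\<lambda>k. the (sol s k)"
  fix k assume "k < dim_vec (unit_vec n i :: real vec)"
  then have k: "k < n" by simp
  have noloop: "(k, k) \<notin> parcs T" using no_loops' by blast
  have nbr: "{j. (k, j) \<in> parcs T} \<subseteq> {0..<n}" using in_arcsD2 V by blast
  have entry: "(laplacian n T + 1\<^sub>m n) $$ (k, j) * ?x j =
      (if j = k then (real (deg T k) + 1) * ?x k else 0) - (if (k, j) \<in> parcs T then ?x j else 0)"
    if "j < n" for j
    using that k noloop
    by (auto simp: laplacian_def degree_mat_def adjacency_mat_def algebra_simps)
  have "((laplacian n T + 1\<^sub>m n) *\<^sub>v bt_output n s) $ k =
      (\<Sum>j\<in>{0..<n}. (laplacian n T + 1\<^sub>m n) $$ (k, j) * ?x j)"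
    using k by (auto simp: scalar_prod_def bt_output_def laplacian_def degree_mat_def
        adjacency_mat_def intro!: sum.cong)
  also have "\<dots> = (\<Sum>j\<in>{0..<n}. (if j = k then (real (deg T k) + 1) * ?x k else 0) -
      (if (k, j) \<in> parcs T then ?x j else 0))"
    by (rule sum.cong[OF refl]) (use entry in simp)
  also have "\<dots> = (real (deg T k) + 1) * ?x k - (\<Sum>j\<in>{0..<n}. if (k, j) \<in> parcs T then ?x j else 0)"
    using k by (simp add: sum_subtractf)
  also have "(\<Sum>j\<in>{0..<n}. if (k, j) \<in> parcs T then ?x j else 0) = (\<Sum>j | (k, j) \<in> parcs T. ?x j)"
    using nbr by (subst sum.inter_filter[symmetric]) (auto intro!: sum.cong)
  also have "(real (deg T k) + 1) * ?x k - \<dots> = (if k = i then 1 else 0)"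
    using sol_equation[OF inv] k V by simp
  finally show "((laplacian n T + 1\<^sub>m n) *\<^sub>v bt_output n s) $ k = unit_vec n i $ k"
    using k root_in V by (simp add: unit_vec_def)
qed (simp add: laplacian_def degree_mat_def adjacency_mat_def)

end

section \<open>The outputs as columns of the inverse matrix\<close>

lemma rooted_nat_treeI:
  "undirected_tree T \<Longrightarrow> pverts T = {0..<n} \<Longrightarrow> i < n \<Longrightarrow> rooted_nat_tree T i"
  by (simp add: rooted_nat_tree_def undirected_tree_rooted)

text \<open>Stated for an arbitrary choice of complete runs, since the independence of the output
  from the choices is only known once the inverse is available.\<close>

lemma right_inverse_of_runs:
  assumes T: "undirected_tree T" "pverts T = {0..<n}"
    and run: "\<And>i. i < n \<Longrightarrow> \<exists>t. bt_run T i (s i) t \<and> phase_of (s i) = Done"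
  shows "(laplacian n T + 1\<^sub>m n) * mat_of_cols n (map (\<lambda>i. bt_output n (s i)) [0..<n]) = 1\<^sub>m n"
    (is "?A * ?X = _")
proof (rule mat_col_eqI)
  have A: "?A \<in> carrier_mat n n" by (simp add: laplacian_def degree_mat_def adjacency_mat_def)
  have X: "?X \<in> carrier_mat n n" using mat_of_cols_carrier(1)[of n "map (\<lambda>i. bt_output n (s i)) [0..<n]"] by simp
  fix i assume "i < dim_col (1\<^sub>m n :: real mat)"
  then have i: "i < n" by simp
  interpret rooted_nat_tree T i using rooted_nat_treeI[OF T i] .
  have "col (?A * ?X) i = ?A *\<^sub>v col ?X i" using col_mult2[OF A X i] .
  also have "col ?X i = bt_output n (s i)"
    using i by (subst col_mat_of_cols) (auto simp: bt_output_def)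
  also have "?A *\<^sub>v bt_output n (s i) = unit_vec n i"
    using run[OF i] laplacian_mult_output[OF T(2)] by blast
  finally show "col (?A * ?X) i = col (1\<^sub>m n) i" using i by simp
qed (simp_all add: laplacian_def degree_mat_def adjacency_mat_def)

text \<open>\<open>B_mat\<close> takes \<open>the\<close> of an option, so
  \<open>mat_inverse\<close> must be shown not to return \<open>None\<close>. Complete runs exist
  and supply a right inverse; for square matrices it is also a left inverse, which makes the matrix
  a unit.\<close>

lemma B_mat_inverse:
  assumes T: "undirected_tree T" "pverts T = {0..<n}"
  shows "B_mat n T \<in> carrier_mat n n" "B_mat n T * (laplacian n T + 1\<^sub>m n) = 1\<^sub>m n"
proof -
  let ?A = "laplacian n T + 1\<^sub>m n"
  have A: "?A \<in> carrier_mat n n" by (simp add: laplacian_def degree_mat_def adjacency_mat_def)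
  have "\<exists>s t. bt_run T i s t \<and> phase_of s = Done" if "i < n" for i
  proof -
    interpret rooted_nat_tree T i using rooted_nat_treeI[OF T that] .
    show ?thesis by (rule ex_complete_run)
  qed
  then obtain s where "\<And>i. i < n \<Longrightarrow> \<exists>t. bt_run T i (s i) t \<and> phase_of (s i) = Done"
    by metis
  from right_inverse_of_runs[OF T this] obtain X where X: "X \<in> carrier_mat n n" "?A * X = 1\<^sub>m n"
    using mat_of_cols_carrier(1)[of n "map (\<lambda>i. bt_output n (s i)) [0..<n]"] by auto
  have "X * ?A = 1\<^sub>m n" by (rule mat_mult_left_right_inverse[OF A X])
  with X A have "?A \<in> Units (ring_mat TYPE(real) n ())"
    by (auto simp: Units_def ring_mat_simps)
  then obtain B where B: "mat_inverse ?A = Some B"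
    using mat_inverse(1)[OF A, of "()"] by (cases "mat_inverse ?A") auto
  then show "B_mat n T \<in> carrier_mat n n" "B_mat n T * ?A = 1\<^sub>m n"
    using mat_inverse(2)[OF A B] by (simp_all add: B_mat_def)
qed

text \<open>Multiplying the system solved by the output with \<open>B_mat n T\<close> from the left
  isolates the output, whatever choices the run made.\<close>

lemma output_eq_col:
  assumes T: "undirected_tree T" "pverts T = {0..<n}" and i: "i < n"
    and run: "bt_run T i s t" "phase_of s = Done"
  shows "bt_output n s = col (B_mat n T) i"
proof -
  interpret rooted_nat_tree T i using rooted_nat_treeI[OF T i] .
  let ?A = "laplacian n T + 1\<^sub>m n" and ?B = "B_mat n T" and ?x = "bt_output n s"
  have A: "?A \<in> carrier_mat n n" by (simp add: laplacian_def degree_mat_def adjacency_mat_def)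
  have x: "?x \<in> carrier_vec n" by (simp add: bt_output_def)
  note B = B_mat_inverse[OF T]
  have "?x = (?B * ?A) *\<^sub>v ?x" using B(2) x by simp
  also have "\<dots> = ?B *\<^sub>v (?A *\<^sub>v ?x)" using assoc_mult_mat_vec[OF B(1) A x] .
  also have "\<dots> = ?B *\<^sub>v unit_vec n i" using laplacian_mult_output[OF T(2) run] by simp
  also have "\<dots> = col ?B i" 
    using col_mult2[OF B(1) one_carrier_mat i] B(1) i by simp
  finally show ?thesis .
qed

text \<open>\<open>f\<close> and \<open>g\<close> are chosen before the tree, so the bounds are
  uniform in all trees and all choices of the algorithm. Termination together with progress before
  \<open>Done\<close> means that every run can be completed and none goes on forever; the existence
  of a matrix computation keeps the last clause from being vacuous.\<close>

theorem theorem4p1: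
  shows "\<exists>f g :: nat \<Rightarrow> real.
    f \<in> O(\<lambda>n. real n) \<and> g \<in> O(\<lambda>n. real n ^ 2) \<and>
    (\<forall>(n :: nat) (T :: nat pair_pre_digraph). undirected_tree T \<and> pverts T = {0..<n} \<longrightarrow>
       (\<forall>i<n.
          (\<nexists>\<sigma>. \<sigma> 0 = init_state i \<and> (\<forall>j. \<exists>c. bt_step T i (\<sigma> j) c (\<sigma> (Suc j)))) \<and>
          (\<forall>s t. bt_run T i s t \<longrightarrow>
             real t \<le> f n \<and>
             (phase_of s \<noteq> Done \<longrightarrow> (\<exists>c s'. bt_step T i s c s')) \<and>
             (phase_of s \<noteq> Orient \<longrightarrow> dtree s = directed_tree T i) \<and>
             agenda_exact s \<and>
             (\<forall>e m. label s e = Some m \<longrightarrow> m \<noteq> 0) \<and>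
             (phase_of s = Done \<longrightarrow> bt_output n s = col (B_mat n T) i))) \<and>
       (\<exists>X t. computes_matrix n T X t) \<and>
       (\<forall>X t. computes_matrix n T X t \<longrightarrow> X = B_mat n T \<and> real t \<le> g n))"
proof (rule exI[where x = "\<lambda>n. 11 * real n + 3"],
    rule exI[where x = "\<lambda>n. real n * (12 * real n + 3)"], intro conjI allI impI)
  \<comment> \<open>\<open>?f\<close> is the bound of \<open>invariant_time\<close>;
    \<open>?g\<close> is \<open>n\<close> times that bound plus the \<open>n\<close> steps for
    storing a column. For \<open>n \<ge> 1\<close> the constant 3 is absorbed, giving the factors 14
    and 15.\<close>
  let ?f = "\<lambda>n. 11 * real n + 3" and ?g = "\<lambda>n. real n * (12 * real n + 3)"
  show "?f \<in> O(\<lambda>n. real n)"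
  proof (rule bigoI)
    show "eventually (\<lambda>n. norm (?f n) \<le> 14 * norm (real n)) sequentially"
      using eventually_ge_at_top[of 1] by eventually_elim simp
  qed
  show "?g \<in> O(\<lambda>n. real n ^ 2)"
  proof (rule bigoI)
    show "eventually (\<lambda>n. norm (?g n) \<le> 15 * norm (real n ^ 2)) sequentially"
      using eventually_ge_at_top[of 1]
    proof eventually_elim
      case (elim n)
      then have "real n * (12 * real n + 3) \<le> real n * (15 * real n)"
        by (intro mult_left_mono) auto
      then show ?case by (simp add: power2_eq_square algebra_simps)
    qed
  qed
  fix n and T :: "nat pair_pre_digraph"
  assume "undirected_tree T \<and> pverts T = {0..<n}"
  then have T: "undirected_tree T" "pverts T = {0..<n}" by simp_all
  have rooted: "rooted_nat_tree T i" if "i < n" for i using rooted_nat_treeI[OF T that] .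
  have time: "real t \<le> ?f n" if "i < n" "bt_run T i s t" for i s t
    using rooted_nat_tree.invariant_time[OF rooted rooted_nat_tree.bt_run_invariant[OF rooted]] that T(2)
    by fastforce
  {
    fix i assume i: "i < n"
    interpret rooted_nat_tree T i using rooted[OF i] .
    show "\<nexists>\<sigma>. \<sigma> 0 = init_state i \<and> (\<forall>j. \<exists>c. bt_step T i (\<sigma> j) c (\<sigma> (Suc j)))"
      by (rule bt_terminates)
    fix s t assume run: "bt_run T i s t"
    note inv = bt_run_invariant[OF run]
    show "real t \<le> ?f n" using time i run .
    show "\<exists>c s'. bt_step T i s c s'" if "phase_of s \<noteq> Done"
      using invariant_progress[OF inv that] .
    show "dtree s = directed_tree T i" if "phase_of s \<noteq> Orient"
      using labels_okD(1)[OF invariant_labels_ok[OF inv that]] .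
    show "agenda_exact s" using invariant_agenda_exact[OF inv] .
    show "m \<noteq> 0" if "label s e = Some m" for e m
      using invariant_label_nonzero[OF inv that] .
    show "bt_output n s = col (B_mat n T) i" if "phase_of s = Done"
      using output_eq_col[OF T i run that] .
  }
  have "\<exists>s t. bt_run T i s t \<and> phase_of s = Done" if "i < n" for i
    using rooted_nat_tree.ex_complete_run[OF rooted[OF that]] .
  then obtain s c where "\<forall>i<n. bt_run T i (s i) (c i) \<and> phase_of (s i) = Done"
    by metis
  then show "\<exists>X t. computes_matrix n T X t"
    unfolding computes_matrix_def by blast
  fix X t assume "computes_matrix n T X t"
  then obtain s c where run: "\<And>i. i < n \<Longrightarrow> bt_run T i (s i) (c i)" "\<And>i. i < n \<Longrightarrow> phase_of (s i) = Done"
    and X: "X = mat_of_cols n (map (\<lambda>i. bt_output n (s i)) [0..<n])" and t: "t = (\<Sum>i<n. c i + n)"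
    unfolding computes_matrix_def by blast
  show "X = B_mat n T"
  proof (rule mat_col_eqI)
    show "dim_row X = dim_row (B_mat n T)" "dim_col X = dim_col (B_mat n T)"
      using X B_mat_inverse(1)[OF T] by auto
    fix i assume "i < dim_col (B_mat n T)"
    then have i: "i < n" using B_mat_inverse(1)[OF T] by simp
    have "col X i = bt_output n (s i)"
      using i X by (subst X, subst col_mat_of_cols) (auto simp: bt_output_def)
    then show "col X i = col (B_mat n T) i"
      using output_eq_col[OF T i run(1)[OF i] run(2)[OF i]] by simp
  qed
  have "real t = (\<Sum>i<n. real (c i) + real n)" using t by simp
  also have "\<dots> \<le> (\<Sum>i<n. 12 * real n + 3)"
    by (rule sum_mono) (use time run(1) in fastforce)
  also have "\<dots> = ?g n" by simp
  finally show "real t \<le> ?g n" .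
qed

end
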